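(* Let $\mathcal{M}=\{M(\theta)=(G(q,\theta),R(q,\theta),H(q,\theta),\Lambda(\theta)),\ \theta\in\Theta\}$ be a network model set, with $L$ nodes, $K$ external excitation signals and noise rank $p\le L$, that satisfies at least one of the conditions (C1), (C2), (C3) listed in the context. Let $U(q,\theta):=\begin{bmatrix}R(q,\theta)&H(q,\theta)\end{bmatrix}$ and $T(q,\theta):=(I-G(q,\theta))^{-1}U(q,\theta)$. (a) Let $\theta_0\in\Theta$ and $\Theta_0:=\{\theta\in\Theta\mid T(q,\theta)=T(q,\theta_0)\}$. If there exists a nonsingular and parameter-independent transfer function matrix $Q\in\mathbb{R}^{(K+p)\times(K+p)}(z)$ such that $$U(q,\theta)Q(q)=\begin{bmatrix}D(q,\theta)&F(q,\theta)\end{bmatrix}$$ with $D(\theta)\in\mathbb{R}^{L\times L}(z)$, $F(\theta)\in\mathbb{R}^{L\times(p+K-L)}(z)$, and $D(q,\theta)$ diagonal and of full rank for all $\theta\in\Theta_0$, then $\mathcal{M}$ is globally network identifiable at $M(\theta_0)$. (b) If there exists such a $Q$ for which $D(q,\theta)$ is diagonal and of full rank for all $\theta\in\Theta$, then for all $\theta_0,\theta_1\in\Theta$ the condition for global network identifiability $$T(q,\theta_1)=T(q,\theta_0)\ \text{ and }\ \Lambda(\theta_1)=\Lambda(\theta_0)\ \Longrightarrow\ M(\theta_1)=M(\theta_0)$$ holds, i.e. it is satisfied at all $M(\theta_0)\in\mathcal{M}$.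
   Context: Notation. $\mathbb{R}^{m\times n}(z)$ is the set of $m\times n$ matrices of real rational functions in $z$ (rank, nonsingularity over the field of rational functions); $q$ is the forward shift operator, so $A(q)$ and $A(z)$ denote the same rational transfer matrix. $A^\infty:=\lim_{z\to\infty}A(z)$; $A_{i\star}$ is the $i$-th row of $A$. "Stable" means all poles in the open unit disc (and proper); a square matrix $A$ is monic if $A^\infty=I$. $(\cdot)^*$ is complex conjugate transpose (on the unit circle $z=e^{i\omega}$). Network model. The network is $w=Gw+Rr+He$ with $w$ the $L$ node signals, $r$ the $K$ measured external excitation signals, $e$ an unmeasured $p$-dimensional white noise with covariance $\Lambda$, $p\le L$. A network model is a quadruple $M=(G,R,H,\Lambda)$ with: $G\in\mathbb{R}^{L\times L}(z)$ having zero diagonal and all entries ("modules") proper and stable; $R\in\mathbb{R}^{L\times K}(z)$ proper; $H\in\mathbb{R}^{L\times p}(z)$ stable, of the form $H=\begin{bmatrix}H_a\\H_b\end{bmatrix}$ with $H_a$ a $p\times p$ monic matrix, and having a stable left inverse $H^\dagger$, $H^\dagger H=I_p$ (for $p=L$: $H$ square, monic, stable, minimum-phase); $\Lambda\in\mathbb{R}^{p\times p}$, $\Lambda>0$; the network is well-posed (all principal minors of $(I-G^\infty)^{-1}$ are nonzero), with $(I-G)^{-1}$ proper and stable. Network model set. A set $\mathcal{M}=\{M(\theta)=(G(q,\theta),R(q,\theta),H(q,\theta),\Lambda(\theta)):\theta\in\Theta\}$ of network models with common $L,K,p$. All models share the same $p$, and the nodes are ordered so that for all models the first $p$ components of $v=He$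 form a full-rank process. Each entry of a parametrized matrix is either parametrized (depends on $\theta$) or fixed (a known value, the same for all $\theta\in\Theta$); in particular the diagonal of $G$ is fixed to $0$. Derived objects. $T_{wr}(q,\theta)=(I-G(q,\theta))^{-1}R(q,\theta)$, $T_{we}(q,\theta)=(I-G(q,\theta))^{-1}H(q,\theta)$, so $T=\begin{bmatrix}T_{wr}&T_{we}\end{bmatrix}$; and $\Phi_{\bar v}(\omega,\theta)=T_{we}(e^{i\omega},\theta)\Lambda(\theta)T_{we}(e^{i\omega},\theta)^*$. Global network identifiability. $\mathcal{M}$ is globally network identifiable at $M(\theta_0)$ if for all $\theta_1\in\Theta$: $T_{wr}(q,\theta_1)=T_{wr}(q,\theta_0)$ and $\Phi_{\bar v}(\omega,\theta_1)=\Phi_{\bar v}(\omega,\theta_0)$ together imply $M(\theta_1)=M(\theta_0)$ (equality of quadruples). Conditions. (C1) $G^\infty(\theta)=0$ for all $\theta\in\Theta$. (C2) There is a permutation matrix $\Pi$ such that $\Pi^TG^\infty(\theta)\Pi$ is upper triangular for all $\theta\in\Theta$ (no algebraic loops), and $H^\infty(\theta)\Lambda(\theta)H^\infty(\theta)^T$ is diagonal for all $\theta\in\Theta$. (C3) For all $\theta\in\Theta$: each row of $\begin{bmatrix}G^\infty(\theta)&R^\infty(\theta)\end{bmatrix}$ has at most $K$ parametrized elements, and for each $i=1,\dots,L$ the matrix $\check T_i^\infty(\theta)$ has full row rank. Here, with $\alpha_i,\beta_i$ the numbers of parametrized elements in row $i$ of $I-G^\infty(\theta)$ and $R^\infty(\theta)$,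 $\check T_i^\infty(\theta)$ is the $\alpha_i\times(K-\beta_i)$ submatrix of $T_{wr}^\infty(\theta)$ with rows indexed by the columns where $G^\infty(\theta)_{i\star}$ is parametrized and columns indexed by the columns where $R^\infty(\theta)_{i\star}$ is not parametrized. *)

theory Defs
  imports
    "HOL-Analysis.Analysis"
    "HOL-Computational_Algebra.Computational_Algebra"
    "HOL-Computational_Algebra.Field_as_Ring"
    "HOL-Combinatorics.Permutations"
    "Jordan_Normal_Form.Matrix"
    "Jordan_Normal_Form.Gauss_Jordan_Elimination"
    "Jordan_Normal_Form.Schur_Decomposition"
    "Jordan_Normal_Form.DL_Rank"
    "Jordan_Normal_Form.DL_Submatrix"
begin

hide_const (open) Finite_Cartesian_Product.mat Finite_Cartesian_Product.vec
  Finite_Cartesian_Product.row Determinants.det Cartesian_Space.rank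

section \<open>Real rational functions\<close>

type_synonym ratfun = "real poly fract"

text \<open>Numerator and denominator are taken from the reduced representation, so the zeros of the
  denominator are exactly the poles.\<close>

definition rf_num :: "ratfun \<Rightarrow> real poly" where
  "rf_num f = fst (quot_of_fract f)"

definition rf_den :: "ratfun \<Rightarrow> real poly" where
  "rf_den f = snd (quot_of_fract f)"

definition rf_eval :: "ratfun \<Rightarrow> complex \<Rightarrow> complex" where
  "rf_eval f z = poly (map_poly complex_of_real (rf_num f)) z
               / poly (map_poly complex_of_real (rf_den f)) z"

definition rf_pole :: "ratfun \<Rightarrow> complex \<Rightarrow> bool" where
  "rf_pole f z \<longleftrightarrow> poly (map_poly complex_of_real (rf_den f)) z = 0"

definition rf_proper :: "ratfun \<Rightarrow> bool" where
  "rf_proper f \<longleftrightarrow> degree (rf_num f) \<le> degree (rf_den f)"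

definition rf_stable :: "ratfun \<Rightarrow> bool" where
  "rf_stable f \<longleftrightarrow> rf_proper f \<and> (\<forall>z. rf_pole f z \<longrightarrow> cmod z < 1)"

text \<open>The limit is over complex arguments; it is real because the coefficients are real.
  The value is meaningful for proper functions only.\<close>

definition rf_inf :: "ratfun \<Rightarrow> real" where
  "rf_inf f = (THE c. (rf_eval f \<longlongrightarrow> complex_of_real c) at_infinity)"


section \<open>Matrices\<close>

definition proper_mat :: "ratfun mat \<Rightarrow> bool" where
  "proper_mat A \<longleftrightarrow> (\<forall>f \<in> elements_mat A. rf_proper f)"

definition stable_mat :: "ratfun mat \<Rightarrow> bool" where
  "stable_mat A \<longleftrightarrow> (\<forall>f \<in> elements_mat A. rf_stable f)"

definition mat_inf :: "ratfun mat \<Rightarrow> real mat" where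
  "mat_inf A = map_mat rf_inf A"

definition mat_eval :: "ratfun mat \<Rightarrow> complex \<Rightarrow> complex mat" where
  "mat_eval A z = map_mat (\<lambda>f. rf_eval f z) A"

definition monic_mat :: "ratfun mat \<Rightarrow> bool" where
  "monic_mat A \<longleftrightarrow> square_mat A \<and> proper_mat A \<and> mat_inf A = 1\<^sub>m (dim_row A)"

text \<open>Unspecified unless the argument is invertible.\<close>

definition minv :: "'a :: field mat \<Rightarrow> 'a mat" where
  "minv A = the (mat_inverse A)"

definition append_cols :: "'a :: zero mat \<Rightarrow> 'a mat \<Rightarrow> 'a mat" where
  "append_cols A B = four_block_mat A B (0\<^sub>m 0 (dim_col A)) (0\<^sub>m 0 (dim_col B))"

definition full_row_rank :: "'a :: field mat \<Rightarrow> bool" where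
  "full_row_rank A \<longleftrightarrow> vec_space.rank (dim_row A) A = dim_row A"

definition pos_def_mat :: "real mat \<Rightarrow> bool" where
  "pos_def_mat A \<longleftrightarrow> square_mat A \<and> transpose_mat A = A \<and>
     (\<forall>v \<in> carrier_vec (dim_row A). v \<noteq> 0\<^sub>v (dim_row A) \<longrightarrow> v \<bullet> (A *\<^sub>v v) > 0)"

definition permutation_mat :: "nat \<Rightarrow> real mat \<Rightarrow> bool" where
  "permutation_mat n P \<longleftrightarrow>
     (\<exists>\<pi>. \<pi> permutes {..<n} \<and> P = mat n n (\<lambda>(i, j). if i = \<pi> j then 1 else 0))"


section \<open>Network models\<close>

record network =
  net_G :: "ratfun mat"
  net_R :: "ratfun mat"
  net_H :: "ratfun mat"
  net_Lambda :: "real mat"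

definition well_posed :: "nat \<Rightarrow> ratfun mat \<Rightarrow> bool" where
  "well_posed L G \<longleftrightarrow> invertible_mat (1\<^sub>m L - mat_inf G) \<and>
     (\<forall>I \<subseteq> {..<L}. det (submatrix (minv (1\<^sub>m L - mat_inf G)) I I) \<noteq> 0)"

definition network_model :: "nat \<Rightarrow> nat \<Rightarrow> nat \<Rightarrow> network \<Rightarrow> bool" where
  "network_model L K p M \<longleftrightarrow>
     p \<le> L \<and>
     net_G M \<in> carrier_mat L L \<and> (\<forall>i<L. net_G M $$ (i, i) = 0) \<and> stable_mat (net_G M) \<and>
     net_R M \<in> carrier_mat L K \<and> proper_mat (net_R M) \<and>
     net_H M \<in> carrier_mat L p \<and> stable_mat (net_H M) \<and>
     (\<exists>Ha \<in> carrier_mat p p. \<exists>Hb \<in> carrier_mat (L - p) p.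
        net_H M = Ha @\<^sub>r Hb \<and> monic_mat Ha) \<and>
     (\<exists>Hd \<in> carrier_mat p L. stable_mat Hd \<and> Hd * net_H M = 1\<^sub>m p) \<and>
     net_Lambda M \<in> carrier_mat p p \<and> pos_def_mat (net_Lambda M) \<and>
     well_posed L (net_G M) \<and>
     invertible_mat (1\<^sub>m L - net_G M) \<and> stable_mat (minv (1\<^sub>m L - net_G M))"

definition T_wr :: "network \<Rightarrow> ratfun mat" where
  "T_wr M = minv (1\<^sub>m (dim_row (net_G M)) - net_G M) * net_R M"

definition T_we :: "network \<Rightarrow> ratfun mat" where
  "T_we M = minv (1\<^sub>m (dim_row (net_G M)) - net_G M) * net_H M"

definition U_mat :: "network \<Rightarrow> ratfun mat" where
  "U_mat M = append_cols (net_R M) (net_H M)"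

definition T_mat :: "network \<Rightarrow> ratfun mat" where
  "T_mat M = minv (1\<^sub>m (dim_row (net_G M)) - net_G M) * U_mat M"

definition noise_spectrum :: "network \<Rightarrow> real \<Rightarrow> complex mat" where
  "noise_spectrum M \<omega> =
     mat_eval (T_we M) (cis \<omega>) * map_mat complex_of_real (net_Lambda M)
       * mat_adjoint (mat_eval (T_we M) (cis \<omega>))"


section \<open>Network model sets and identifiability\<close>

text \<open>A model set is an index set \<open>\<Theta>\<close> together with the map \<open>\<theta> \<mapsto> M(\<theta>)\<close>.  The requirement that the
  first \<open>p\<close> noise components form a full-rank process is not a separate conjunct, since it follows
  from \<open>Ha\<close> being monic and \<open>\<Lambda>\<close> being positive definite.\<close>

definition network_model_set ::
  "nat \<Rightarrow> nat \<Rightarrow> nat \<Rightarrow> 't set \<Rightarrow> ('t \<Rightarrow> network) \<Rightarrow> bool" where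
  "network_model_set L K p \<Theta> M \<longleftrightarrow> p \<le> L \<and> (\<forall>\<theta>\<in>\<Theta>. network_model L K p (M \<theta>))"

definition globally_identifiable_at :: "'t set \<Rightarrow> ('t \<Rightarrow> network) \<Rightarrow> 't \<Rightarrow> bool" where
  "globally_identifiable_at \<Theta> M \<theta>0 \<longleftrightarrow>
     (\<forall>\<theta>1\<in>\<Theta>. T_wr (M \<theta>1) = T_wr (M \<theta>0) \<and>
        (\<forall>\<omega>. noise_spectrum (M \<theta>1) \<omega> = noise_spectrum (M \<theta>0) \<omega>)
        \<longrightarrow> M \<theta>1 = M \<theta>0)"

text \<open>An entry is fixed if it has the same value for all \<open>\<theta> \<in> \<Theta>\<close>, and parametrized otherwise.\<close>

definition parametrized :: "'t set \<Rightarrow> ('t \<Rightarrow> real mat) \<Rightarrow> nat \<Rightarrow> nat \<Rightarrow> bool" where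
  "parametrized \<Theta> A i j \<longleftrightarrow> (\<exists>\<theta>1\<in>\<Theta>. \<exists>\<theta>2\<in>\<Theta>. A \<theta>1 $$ (i, j) \<noteq> A \<theta>2 $$ (i, j))"

definition G_inf :: "('t \<Rightarrow> network) \<Rightarrow> 't \<Rightarrow> real mat" where
  "G_inf M \<theta> = mat_inf (net_G (M \<theta>))"

definition R_inf :: "('t \<Rightarrow> network) \<Rightarrow> 't \<Rightarrow> real mat" where
  "R_inf M \<theta> = mat_inf (net_R (M \<theta>))"

definition H_inf :: "('t \<Rightarrow> network) \<Rightarrow> 't \<Rightarrow> real mat" where
  "H_inf M \<theta> = mat_inf (net_H (M \<theta>))"

definition cond_C1 :: "nat \<Rightarrow> 't set \<Rightarrow> ('t \<Rightarrow> network) \<Rightarrow> bool" where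
  "cond_C1 L \<Theta> M \<longleftrightarrow> (\<forall>\<theta>\<in>\<Theta>. G_inf M \<theta> = 0\<^sub>m L L)"

definition cond_C2 :: "nat \<Rightarrow> 't set \<Rightarrow> ('t \<Rightarrow> network) \<Rightarrow> bool" where
  "cond_C2 L \<Theta> M \<longleftrightarrow>
     (\<exists>P. permutation_mat L P \<and>
        (\<forall>\<theta>\<in>\<Theta>. upper_triangular (transpose_mat P * G_inf M \<theta> * P))) \<and>
     (\<forall>\<theta>\<in>\<Theta>. diagonal_mat (H_inf M \<theta> * net_Lambda (M \<theta>) * transpose_mat (H_inf M \<theta>)))"

definition T_check_inf ::
  "nat \<Rightarrow> nat \<Rightarrow> 't set \<Rightarrow> ('t \<Rightarrow> network) \<Rightarrow> nat \<Rightarrow> 't \<Rightarrow> real mat" where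
  "T_check_inf L K \<Theta> M i \<theta> =
     submatrix (mat_inf (T_wr (M \<theta>)))
       {j. j < L \<and> parametrized \<Theta> (G_inf M) i j}
       {k. k < K \<and> \<not> parametrized \<Theta> (R_inf M) i k}"

definition cond_C3 :: "nat \<Rightarrow> nat \<Rightarrow> 't set \<Rightarrow> ('t \<Rightarrow> network) \<Rightarrow> bool" where
  "cond_C3 L K \<Theta> M \<longleftrightarrow>
     (\<forall>\<theta>\<in>\<Theta>. \<forall>i<L.
        card {j. j < L \<and> parametrized \<Theta> (G_inf M) i j}
          + card {k. k < K \<and> parametrized \<Theta> (R_inf M) i k} \<le> K \<and>
        full_row_rank (T_check_inf L K \<Theta> M i \<theta>))"

text \<open>The equation \<open>U Q = [D F]\<close> can only hold if \<open>L \<le> p + K\<close>, because \<open>U Q\<close> has \<open>K + p\<close> columns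
  and \<open>D\<close> has \<open>L\<close>; hence the subtraction below does not truncate.\<close>

definition diagonal_factorization ::
  "nat \<Rightarrow> nat \<Rightarrow> nat \<Rightarrow> ratfun mat \<Rightarrow> network \<Rightarrow> bool" where
  "diagonal_factorization L K p Q N \<longleftrightarrow>
     (\<exists>D \<in> carrier_mat L L. \<exists>F \<in> carrier_mat L (p + K - L).
        U_mat N * Q = append_cols D F \<and> diagonal_mat D \<and> vec_space.rank L D = L)"

end

theory Submission
  imports Defs
begin

text \<open>Two models with the same \<open>T_wr\<close> and the same noise spectrum have spectral factors \<open>T_we\<close>
  that are stable with stable left inverse, so \<open>T_we(\<theta>1) = T_we(\<theta>0) X\<close> where the entries of \<open>X\<close>
  have no pole outside the open unit disc, and, being conjugate on the circle to stable functions,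
  no pole inside it either. Hence \<open>X\<close> is a constant matrix with \<open>X \<Lambda>(\<theta>1) X\<^sup>T = \<Lambda>(\<theta>0)\<close>. At \<open>z = \<infinity>\<close>
  the top block of \<open>H\<close> is the identity; under (C1) and (C3) the two feedthrough matrices \<open>G\<^sup>\<infinity>\<close>
  agree, which gives \<open>X = I\<close> directly, while under (C2) \<open>X\<close> is unitriangular up to a permutation and
  takes one positive diagonal matrix to another by congruence, so again \<open>X = I\<close>. Thus \<open>T\<close> and \<open>\<Lambda>\<close> agree.
  From \<open>T Q = (I - G)\<^sup>-\<^sup>1 [D F]\<close> one then gets that \<open>(I - G(\<theta>1)) (I - G(\<theta>0))\<^sup>-\<^sup>1\<close> maps one
  diagonal matrix to another and is therefore diagonal, and the zero diagonal of \<open>G\<close> forces it to be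
  the identity.\<close>

subsection \<open>Real rational functions\<close>

abbreviation cpoly :: "real poly \<Rightarrow> complex \<Rightarrow> complex" where
  "cpoly p z \<equiv> poly (map_poly complex_of_real p) z"

lemma cpoly_pCons: "cpoly (pCons a p) z = of_real a + z * cpoly p z"
proof -
  have "map_poly complex_of_real (pCons a p) = pCons (of_real a) (map_poly of_real p)"
    by (rule poly_eqI) (simp add: coeff_map_poly coeff_pCons split: nat.split)
  then show ?thesis by simp
qed

lemma cpoly_add: "cpoly (p + q) z = cpoly p z + cpoly q z"
proof -
  have "map_poly complex_of_real (p + q) = map_poly of_real p + map_poly of_real q"
    by (rule poly_eqI) (simp add: coeff_map_poly)
  then show ?thesis by simp
qed

lemma cpoly_smult: "cpoly (Polynomial.smult a q) z = of_real a * cpoly q z"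
proof -
  have "map_poly complex_of_real (Polynomial.smult a q) = Polynomial.smult (of_real a) (map_poly of_real q)"
    by (rule poly_eqI) (simp add: coeff_map_poly)
  then show ?thesis by simp
qed

lemma cpoly_mult: "cpoly (p * q) z = cpoly p z * cpoly q z"
  by (induction p) (simp_all add: cpoly_pCons cpoly_add cpoly_smult algebra_simps)

text \<open>On the unit circle conjugation is inversion; reflection turns values at
  \<open>inverse z\<close> back into values of a polynomial at \<open>z\<close>.\<close>

lemma cpoly_reflect_poly:
  assumes "z \<noteq> 0"
  shows "cpoly (reflect_poly p) z = z ^ degree p * cpoly p (inverse z)"
proof -
  have "map_poly complex_of_real (reflect_poly p) = reflect_poly (map_poly of_real p)"
    by (rule poly_eqI) (simp add: coeff_map_poly coeff_reflect_poly degree_map_poly)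
  then show ?thesis
    using assms by (simp add: poly_reflect_poly_nz degree_map_poly)
qed

lemma cnj_cpoly: "cnj (cpoly p z) = cpoly p (cnj z)"
  by (induction p) (simp_all add: cpoly_pCons)

lemma infinite_range_cis: "infinite (range cis)"
proof
  assume "finite (range cis)"
  moreover have "cis ` {-pi<..pi} \<subseteq> range cis" by auto
  moreover have "inj_on cis {-pi<..pi}"
    \<comment> \<open>\<open>Arg\<close> recovers the angle on this half-open interval.\<close>
    by (rule inj_onI) (metis Arg_cis greaterThanAtMost_iff)
  ultimately have "finite {-pi<..pi}"
    by (meson finite_imageD finite_subset)
  then show False
    using infinite_Ioc[of "-pi" pi] by simp
qed

text \<open>The difference vanishes on the circle, an infinite set, so it is the zero
  polynomial.\<close>

lemma cpoly_eq_on_circle: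
  assumes "\<And>\<omega>. cpoly p (cis \<omega>) = cpoly q (cis \<omega>)"
  shows "p = q"
proof -
  let ?r = "map_poly complex_of_real (p - q)"
  have "range cis \<subseteq> {z. poly ?r z = 0}"
  proof clarify
    fix \<omega>
    have "cpoly ((p - q) + q) (cis \<omega>) = cpoly q (cis \<omega>)"
      using assms by simp
    then show "poly ?r (cis \<omega>) = 0"
      unfolding cpoly_add by simp
  qed
  then have "?r = 0"
    using infinite_range_cis poly_roots_finite finite_subset by blast
  then have "coeff (p - q) n = 0" for n
    by (metis coeff_0 coeff_map_poly of_real_0 of_real_eq_0_iff)
  then show ?thesis
    by (metis eq_iff_diff_eq_0 leading_coeff_0_iff)
qed

section \<open>Reduced fractions, poles and properness\<close>

lemma rf_den_nonzero: "rf_den f \<noteq> 0"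
  and coprime_rf_num_den: "coprime (rf_num f) (rf_den f)"
  using quot_of_fract_in_normalized_fracts[of f]
  by (auto simp: rf_num_def rf_den_def normalized_fracts_def split: prod.splits)

lemma Fract_rf_num_den: "Fract (rf_num f) (rf_den f) = f"
  using quot_to_fract_quot_of_fract[of f]
  by (simp add: quot_to_fract_def rf_num_def rf_den_def split: prod.splits)

lemma cross_rf_num_den:
  assumes "b \<noteq> 0"
  shows "a * rf_den (Fract a b) = rf_num (Fract a b) * b"
  using Fract_rf_num_den[of "Fract a b"] assms rf_den_nonzero[of "Fract a b"]
  by (simp add: eq_fract)

text \<open>Cross-multiplication makes the reduced denominator divide
  \<open>rf_num (Fract a b) * b\<close>, and it is coprime to the first factor. Hence poles lie
  among the zeros of any denominator.\<close>

lemma rf_den_Fract_dvd: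
  assumes "b \<noteq> 0"
  shows "rf_den (Fract a b) dvd b"
proof -
  have "rf_den (Fract a b) dvd rf_num (Fract a b) * b"
    using cross_rf_num_den[OF assms, of a] by (metis dvd_triv_right)
  then show ?thesis
    using coprime_rf_num_den coprime_commute coprime_dvd_mult_right_iff by blast
qed

text \<open>Evaluation is defined through the reduced representation; this frees later computations
  to use any denominator that does not vanish at \<open>z\<close>.\<close>

lemma rf_eval_Fract:
  assumes "cpoly b z \<noteq> 0"
  shows "\<not> rf_pole (Fract a b) z" "rf_eval (Fract a b) z = cpoly a z / cpoly b z"
proof -
  have b: "b \<noteq> 0" using assms by auto
  show np: "\<not> rf_pole (Fract a b) z"
    using rf_den_Fract_dvd[OF b, of a] assms unfolding rf_pole_def
    by (metis cpoly_mult dvdE mult_zero_left)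
  have "cpoly a z * cpoly (rf_den (Fract a b)) z = cpoly (rf_num (Fract a b)) z * cpoly b z"
    using cross_rf_num_den[OF b, of a] by (metis cpoly_mult)
  then show "rf_eval (Fract a b) z = cpoly a z / cpoly b z"
    using np assms by (simp add: rf_eval_def rf_pole_def field_simps)
qed

text \<open>Cancelling common factors preserves the difference of the degrees, as the
  cross-multiplied identity shows.\<close>

lemma rf_proper_Fract:
  assumes "b \<noteq> 0" "degree a \<le> degree b"
  shows "rf_proper (Fract a b)"
\<comment> \<open>The degree formula for products requires nonzero factors, so a vanishing numerator
  is treated apart.\<close>
proof (cases "rf_num (Fract a b) = 0")
  case True
  then show ?thesis by (simp add: rf_proper_def)
next
  case False
  have "a \<noteq> 0"
    using cross_rf_num_den[OF assms(1), of a] False assms(1) by auto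
  then have "degree (a * rf_den (Fract a b)) = degree a + degree (rf_den (Fract a b))"
    by (simp add: degree_mult_eq rf_den_nonzero)
  moreover have "degree (rf_num (Fract a b) * b) = degree (rf_num (Fract a b)) + degree b"
    using False assms(1) by (simp add: degree_mult_eq)
  ultimately have "degree a + degree (rf_den (Fract a b)) = degree (rf_num (Fract a b)) + degree b"
    using cross_rf_num_den[OF assms(1), of a] by simp
  then show ?thesis using assms(2) by (simp add: rf_proper_def)
qed

section \<open>Constants and closure under ring operations\<close>

definition rf_const :: "real \<Rightarrow> ratfun" where
  "rf_const c = Fract [:c:] 1"

lemma rf_add_Fract:
  "f + g = Fract (rf_num f * rf_den g + rf_num g * rf_den f) (rf_den f * rf_den g)"
  using add_fract[OF rf_den_nonzero[of f] rf_den_nonzero[of g], of "rf_num f" "rf_num g"]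
  by (simp add: Fract_rf_num_den)

lemma rf_mult_Fract: "f * g = Fract (rf_num f * rf_num g) (rf_den f * rf_den g)"
  using mult_fract[of "rf_num f" "rf_den f" "rf_num g" "rf_den g"] by (simp add: Fract_rf_num_den)

lemma rf_add_regular:
  assumes "\<not> rf_pole f z" "\<not> rf_pole g z"
  shows "\<not> rf_pole (f + g) z" "rf_eval (f + g) z = rf_eval f z + rf_eval g z"
proof -
  have "cpoly (rf_den f * rf_den g) z \<noteq> 0"
    using assms by (simp add: rf_pole_def cpoly_mult)
  note Fract = rf_eval_Fract[OF this, of "rf_num f * rf_den g + rf_num g * rf_den f",
      folded rf_add_Fract]
  show "\<not> rf_pole (f + g) z" by (fact Fract(1))
  show "rf_eval (f + g) z = rf_eval f z + rf_eval g z"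
    using assms unfolding Fract(2) unfolding rf_eval_def rf_pole_def cpoly_add cpoly_mult
    by (simp add: add_frac_eq)
qed

lemma rf_mult_regular:
  assumes "\<not> rf_pole f z" "\<not> rf_pole g z"
  shows "\<not> rf_pole (f * g) z" "rf_eval (f * g) z = rf_eval f z * rf_eval g z"
proof -
  have "cpoly (rf_den f * rf_den g) z \<noteq> 0"
    using assms by (simp add: rf_pole_def cpoly_mult)
  note Fract = rf_eval_Fract[OF this, of "rf_num f * rf_num g", folded rf_mult_Fract]
  show "\<not> rf_pole (f * g) z" by (fact Fract(1))
  show "rf_eval (f * g) z = rf_eval f z * rf_eval g z"
    unfolding Fract(2) unfolding rf_eval_def cpoly_mult by simp
qed

lemma rf_const_regular: "\<not> rf_pole (rf_const c) z" "rf_eval (rf_const c) z = of_real c"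
  using rf_eval_Fract[of 1 z "[:c:]"] by (simp_all add: rf_const_def cpoly_pCons)

lemma rf_const_0: "rf_const 0 = 0" and rf_const_1: "rf_const 1 = 1"
  by (simp_all add: rf_const_def Zero_fract_def One_fract_def one_pCons)

lemma rf_const_minus_1: "rf_const (- 1) = - 1"
  by (simp add: rf_const_def One_fract_def one_pCons)

text \<open>Reduces statements about differences to those about sums, products and
  constants.\<close>

lemma rf_diff_eq: "f - g = f + rf_const (- 1) * g"
  by (simp add: rf_const_minus_1)

lemma rf_proper_add: "rf_proper f \<Longrightarrow> rf_proper g \<Longrightarrow> rf_proper (f + g)"
  unfolding rf_add_Fract[of f g]
  by (rule rf_proper_Fract)
    (auto simp: rf_den_nonzero rf_proper_def degree_mult_eq
      intro!: degree_add_le order_trans[OF degree_mult_le])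

lemma rf_proper_mult: "rf_proper f \<Longrightarrow> rf_proper g \<Longrightarrow> rf_proper (f * g)"
  unfolding rf_mult_Fract[of f g]
  by (rule rf_proper_Fract)
    (auto simp: rf_den_nonzero rf_proper_def degree_mult_eq
      intro!: order_trans[OF degree_mult_le])

lemma rf_proper_const: "rf_proper (rf_const c)"
  unfolding rf_const_def by (rule rf_proper_Fract) simp_all

lemma rf_stable_add: "rf_stable f \<Longrightarrow> rf_stable g \<Longrightarrow> rf_stable (f + g)"
  unfolding rf_stable_def using rf_proper_add rf_add_regular(1) by blast

lemma rf_stable_mult: "rf_stable f \<Longrightarrow> rf_stable g \<Longrightarrow> rf_stable (f * g)"
  unfolding rf_stable_def using rf_proper_mult rf_mult_regular(1) by blast

lemma rf_stable_const: "rf_stable (rf_const c)"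
  by (simp add: rf_stable_def rf_proper_const rf_const_regular)

lemma rf_stable_diff: "rf_stable f \<Longrightarrow> rf_stable g \<Longrightarrow> rf_stable (f - g)"
  unfolding rf_diff_eq[of f g] by (intro rf_stable_add rf_stable_mult rf_stable_const)

lemma rf_stable_imp_proper: "rf_stable f \<Longrightarrow> rf_proper f"
  by (simp add: rf_stable_def)

lemma rf_stable_circle: "rf_stable f \<Longrightarrow> \<not> rf_pole f (cis \<omega>)"
  unfolding rf_stable_def by (metis norm_cis less_irrefl)

section \<open>Values at infinity\<close>

lemma tendsto_cpoly_over_power:
  assumes "degree p \<le> n"
  shows "((\<lambda>z. cpoly p z / z ^ n) \<longlongrightarrow> of_real (coeff p n)) at_infinity"
proof (cases "degree p = n")
  case True
  then show ?thesis
    using poly_divide_tendsto_aux[of "map_poly complex_of_real p"]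
    by (simp add: degree_map_poly coeff_map_poly)
next
  case False
  define m where "m = n - degree p"
  have m: "m > 0" "n = degree p + m" using False assms by (auto simp: m_def)
  have "((\<lambda>z::complex. inverse z ^ m) \<longlongrightarrow> 0 ^ m) at_infinity"
    by (intro tendsto_power tendsto_inverse_0)
  from tendsto_mult[OF poly_divide_tendsto_aux[of "map_poly complex_of_real p"] this]
  have "((\<lambda>z. cpoly p z / z ^ n) \<longlongrightarrow> 0) at_infinity"
    using m by (simp add: degree_map_poly power_add zero_power field_simps)
  then show ?thesis
    using m by (simp add: coeff_eq_0)
qed

text \<open>Divided by its leading power, the denominator tends to its nonzero leading
  coefficient.\<close>

lemma eventually_not_rf_pole: "\<forall>\<^sub>F z in at_infinity. \<not> rf_pole f z"
proof -
  have "((\<lambda>z. cpoly (rf_den f) z / z ^ degree (rf_den f))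
      \<longlongrightarrow> of_real (lead_coeff (rf_den f))) at_infinity"
    by (rule tendsto_cpoly_over_power) simp
  then have "\<forall>\<^sub>F z in at_infinity. cpoly (rf_den f) z / z ^ degree (rf_den f) \<noteq> 0"
    by (rule tendsto_imp_eventually_ne) (simp add: rf_den_nonzero)
  then show ?thesis
    by (rule eventually_mono) (auto simp: rf_pole_def)
qed

lemma rf_inf_eqI:
  assumes "(rf_eval f \<longlongrightarrow> of_real c) at_infinity"
  shows "rf_inf f = c"
  unfolding rf_inf_def
proof (rule the_equality)
  show "d = c" if "(rf_eval f \<longlongrightarrow> of_real d) at_infinity" for d
    using tendsto_unique[OF trivial_limit_at_infinity that assms] by simp
qed fact

text \<open>Numerator and denominator are both divided by \<open>z\<close> to the degree of the
  denominator; properness makes the first quotient converge, possibly to 0. Uniqueness of the limit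
  identifies it with \<open>rf_inf f\<close>.\<close>

lemma rf_eval_tendsto_inf:
  assumes "rf_proper f"
  shows "(rf_eval f \<longlongrightarrow> of_real (rf_inf f)) at_infinity"
proof -
  let ?n = "degree (rf_den f)"
  let ?c = "coeff (rf_num f) ?n / lead_coeff (rf_den f)"
  have "((\<lambda>z. (cpoly (rf_num f) z / z ^ ?n) / (cpoly (rf_den f) z / z ^ ?n))
      \<longlongrightarrow> of_real (coeff (rf_num f) ?n) / of_real (lead_coeff (rf_den f))) at_infinity"
    using assms by (intro tendsto_divide tendsto_cpoly_over_power)
      (simp_all add: rf_proper_def rf_den_nonzero)
  moreover have "\<forall>\<^sub>F z in at_infinity.
      (cpoly (rf_num f) z / z ^ ?n) / (cpoly (rf_den f) z / z ^ ?n) = rf_eval f z"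
    using eventually_not_equal_at_infinity[of 0]
    by (rule eventually_mono) (simp add: rf_eval_def)
  ultimately have "(rf_eval f \<longlongrightarrow> of_real ?c) at_infinity"
    by (simp add: tendsto_cong)
  with rf_inf_eqI[OF this] show ?thesis by simp
qed

lemma rf_inf_add:
  assumes "rf_proper f" "rf_proper g"
  shows "rf_inf (f + g) = rf_inf f + rf_inf g"
proof (rule rf_inf_eqI)
  have "\<forall>\<^sub>F z in at_infinity. rf_eval f z + rf_eval g z = rf_eval (f + g) z"
    using eventually_not_rf_pole[of f] eventually_not_rf_pole[of g]
    by eventually_elim (simp add: rf_add_regular)
  with tendsto_add[OF rf_eval_tendsto_inf[OF assms(1)] rf_eval_tendsto_inf[OF assms(2)]]
  show "(rf_eval (f + g) \<longlongrightarrow> of_real (rf_inf f + rf_inf g)) at_infinity"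
    by (simp add: tendsto_cong)
qed

lemma rf_inf_mult:
  assumes "rf_proper f" "rf_proper g"
  shows "rf_inf (f * g) = rf_inf f * rf_inf g"
proof (rule rf_inf_eqI)
  have "\<forall>\<^sub>F z in at_infinity. rf_eval f z * rf_eval g z = rf_eval (f * g) z"
    using eventually_not_rf_pole[of f] eventually_not_rf_pole[of g]
    by eventually_elim (simp add: rf_mult_regular)
  with tendsto_mult[OF rf_eval_tendsto_inf[OF assms(1)] rf_eval_tendsto_inf[OF assms(2)]]
  show "(rf_eval (f * g) \<longlongrightarrow> of_real (rf_inf f * rf_inf g)) at_infinity"
    by (simp add: tendsto_cong)
qed

lemma rf_inf_const: "rf_inf (rf_const c) = c"
proof (rule rf_inf_eqI)
  have "rf_eval (rf_const c) = (\<lambda>_. of_real c)"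
    by (rule ext) (rule rf_const_regular)
  then show "(rf_eval (rf_const c) \<longlongrightarrow> of_real c) at_infinity" by simp
qed

lemma rf_inf_0: "rf_inf 0 = 0" and rf_inf_1: "rf_inf 1 = 1"
  using rf_inf_const[of 0] rf_inf_const[of 1] by (simp_all add: rf_const_0 rf_const_1)

lemma rf_inf_diff:
  assumes "rf_proper f" "rf_proper g"
  shows "rf_inf (f - g) = rf_inf f - rf_inf g"
  unfolding rf_diff_eq[of f g]
  using assms by (simp add: rf_inf_add rf_inf_mult rf_proper_mult rf_proper_const rf_inf_const)

section \<open>Rational functions determined by the unit circle\<close>

text \<open>Stability excludes poles on the circle, so the equality can be cross-multiplied into one
  of polynomials.\<close>

lemma rf_eq_on_circle:
  assumes "rf_stable f" "rf_stable g"
    and "\<And>\<omega>. rf_eval f (cis \<omega>) = rf_eval g (cis \<omega>)"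
  shows "f = g"
proof -
  have "cpoly (rf_num f * rf_den g) (cis \<omega>) = cpoly (rf_num g * rf_den f) (cis \<omega>)" for \<omega>
    using assms(3)[of \<omega>] rf_stable_circle[OF assms(1), of \<omega>] rf_stable_circle[OF assms(2), of \<omega>]
    by (simp add: rf_eval_def rf_pole_def cpoly_mult field_simps)
  then have "rf_num f * rf_den g = rf_num g * rf_den f"
    by (rule cpoly_eq_on_circle)
  then have "Fract (rf_num f) (rf_den f) = Fract (rf_num g) (rf_den g)"
    by (simp add: eq_fract rf_den_nonzero)
  then show ?thesis by (simp add: Fract_rf_num_den)
qed

text \<open>This replaces Liouville's theorem: on the unit circle \<open>cnj (h z) = h (1 / z)\<close>, so the poles
  of \<open>f\<close> would have to lie both inside and outside the circle.\<close>

lemma rf_stable_conj_stable_const: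
  assumes f: "rf_stable f" and h: "rf_stable h"
    and eq: "\<And>\<omega>. rf_eval f (cis \<omega>) = cnj (rf_eval h (cis \<omega>))"
  shows "\<exists>c. f = rf_const c"
proof -
  define a b c d where "a = rf_num f" and "b = rf_den f" and "c = rf_num h" and "d = rf_den h"
  have b0: "b \<noteq> 0" and d0: "d \<noteq> 0" by (simp_all add: b_def d_def rf_den_nonzero)
  have cd: "degree c \<le> degree d" and ab: "degree a \<le> degree b"
    using f h by (simp_all add: rf_stable_def rf_proper_def a_def b_def c_def d_def)
  \<comment> \<open>Reflecting \<open>c\<close> only supplies the factor
    \<open>z ^ degree c\<close>; the monomial of degree \<open>m\<close> raises it to
    \<open>z ^ degree d\<close>, the factor supplied by reflecting \<open>d\<close>.\<close>
  define m where "m = degree d - degree c"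
  have "cpoly (a * reflect_poly d) (cis \<omega>) = cpoly (b * (monom 1 m * reflect_poly c)) (cis \<omega>)" for \<omega>
  proof -
    define z where "z = cis \<omega>"
    have z0: "z \<noteq> 0" and zc: "cnj z = inverse z"
      by (simp_all add: z_def cis_cnj)
    have bz: "cpoly b z \<noteq> 0" and "cpoly d z \<noteq> 0"
      using rf_stable_circle[OF f] rf_stable_circle[OF h]
      by (simp_all add: rf_pole_def b_def d_def z_def)
    then have dz: "cpoly d (inverse z) \<noteq> 0"
      by (metis cnj_cpoly complex_cnj_zero_iff zc)
    have "cpoly a z / cpoly b z = cpoly c (inverse z) / cpoly d (inverse z)"
      using eq[of \<omega>] by (simp add: rf_eval_def a_def b_def c_def d_def z_def[symmetric] cnj_cpoly zc)
    then have *: "cpoly a z * cpoly d (inverse z) = cpoly b z * cpoly c (inverse z)"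
      using bz dz by (simp add: field_simps)
    have "z ^ degree d = z ^ m * z ^ degree c"
      using cd by (simp add: m_def flip: power_add)
    then have "cpoly (a * reflect_poly d) z = cpoly (b * (monom 1 m * reflect_poly c)) z"
      using * by (simp add: cpoly_mult poly_monom cpoly_reflect_poly z0 algebra_simps)
    then show ?thesis by (simp add: z_def)
  qed
  then have "a * reflect_poly d = b * (monom 1 m * reflect_poly c)"
    by (rule cpoly_eq_on_circle)
  then have "b dvd a * reflect_poly d" by simp
  \<comment> \<open>As \<open>a\<close> and \<open>b\<close> are coprime, every pole of
    \<open>f\<close> is a zero of the reflected denominator of \<open>h\<close>.\<close>
  then have b_dvd: "b dvd reflect_poly d"
    using coprime_rf_num_den[of f] coprime_commute coprime_dvd_mult_right_iff
    unfolding a_def b_def by blast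
  have "degree b = 0"
  proof (rule ccontr)
    assume "degree b \<noteq> 0"
    then have "\<not> constant (poly (map_poly complex_of_real b))"
      by (simp add: constant_degree degree_map_poly)
    then obtain z where z: "cpoly b z = 0"
      using fundamental_theorem_of_algebra by blast
    then have "cmod z < 1"
      using f by (simp add: rf_stable_def rf_pole_def b_def)
    have dz: "cpoly (reflect_poly d) z = 0"
      using b_dvd z by (auto simp: cpoly_mult elim!: dvdE)
    show False
    \<comment> \<open>Reflection relates \<open>z\<close> to \<open>inverse z\<close> only for
      nonzero \<open>z\<close>; at 0 its value is the nonzero leading coefficient of
      \<open>d\<close>.\<close>
    proof (cases "z = 0")
      case True
      have "cpoly (reflect_poly d) 0 = of_real (lead_coeff d)"
        by (simp add: poly_0_coeff_0 coeff_map_poly)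
      then show False using dz d0 True by simp
    next
      case False
      then have "cpoly d (inverse z) = 0"
        using dz by (simp add: cpoly_reflect_poly)
      then have "cmod (inverse z) < 1"
        using h by (simp add: rf_stable_def rf_pole_def d_def)
      then show False
        using \<open>cmod z < 1\<close> False by (simp add: norm_inverse inverse_less_1_iff)
    qed
  qed
  \<comment> \<open>The denominator is constant, and properness makes the numerator constant as
    well.\<close>
  with ab obtain \<alpha> \<beta> where const: "a = [:\<alpha>:]" "b = [:\<beta>:]"
    by (metis degree_eq_zeroE le_zero_eq)
  have "f = Fract a b"
    unfolding a_def b_def by (rule Fract_rf_num_den[symmetric])
  also have "\<dots> = rf_const (\<alpha> / \<beta>)"
    using b0 unfolding const by (simp add: rf_const_def eq_fract)
  finally show ?thesis ..
qed

subsection \<open>Matrices of rational functions\<close>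

lemma mat_mult_assoc_dim:
  "dim_col A = dim_row B \<Longrightarrow> dim_col B = dim_row C \<Longrightarrow> A * B * C = A * (B * C)"
  for A B C :: "'a :: semiring_0 mat"
  by (rule assoc_mult_mat[of A "dim_row A" "dim_col A" B "dim_col B" C "dim_col C"]) auto

lemma mat_mult_left_cancel:
  "A * B = 1\<^sub>m n \<Longrightarrow> A \<in> carrier_mat n m \<Longrightarrow> B \<in> carrier_mat m n \<Longrightarrow> C \<in> carrier_mat n k
    \<Longrightarrow> A * (B * C) = C"
  for A B C :: "'a :: semiring_1 mat"
  using assoc_mult_mat[of A n m B n C k] left_mult_one_mat[of C n k] by simp

lemma index_mult_mat_sum:
  "A \<in> carrier_mat nr n \<Longrightarrow> B \<in> carrier_mat n nc \<Longrightarrow> i < nr \<Longrightarrow> j < nc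
    \<Longrightarrow> (A * B) $$ (i, j) = (\<Sum>k<n. A $$ (i, k) * B $$ (k, j))"
  by (auto simp: scalar_prod_def atLeast0LessThan intro!: sum.cong)

lemma mat_eq_entries:
  "A \<in> carrier_mat nr nc \<Longrightarrow> B \<in> carrier_mat nr nc
    \<Longrightarrow> (\<And>i j. i < nr \<Longrightarrow> j < nc \<Longrightarrow> A $$ (i, j) = B $$ (i, j)) \<Longrightarrow> A = B"
  by (rule eq_matI) auto

text \<open>Evaluation on the circle is multiplicative on stable functions, and
  \<open>rf_inf\<close> on proper ones, but neither on all rational functions. The carrier
  \<open>S\<close> records this restriction, so that one argument transfers both maps, as well as
  \<open>cnj\<close> and \<open>complex_of_real\<close>, to matrix products.\<close>

locale partial_hom =
  fixes S :: "'a :: semiring_0 set" and h :: "'a \<Rightarrow> 'b :: semiring_0"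
  assumes zero_mem: "0 \<in> S"
    and add_mem: "x \<in> S \<Longrightarrow> y \<in> S \<Longrightarrow> x + y \<in> S"
    and mult_mem: "x \<in> S \<Longrightarrow> y \<in> S \<Longrightarrow> x * y \<in> S"
    and hom_zero: "h 0 = 0"
    and hom_add: "x \<in> S \<Longrightarrow> y \<in> S \<Longrightarrow> h (x + y) = h x + h y"
    and hom_mult: "x \<in> S \<Longrightarrow> y \<in> S \<Longrightarrow> h (x * y) = h x * h y"
begin

lemma sum_mem_hom:
  assumes "\<And>k. k \<in> I \<Longrightarrow> f k \<in> S"
  shows "sum f I \<in> S \<and> h (sum f I) = (\<Sum>k\<in>I. h (f k))"
  using assms by (induction I rule: infinite_finite_induct)
    (simp_all add: zero_mem add_mem hom_zero hom_add)

lemma mult_mat_mem: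
  assumes A: "A \<in> carrier_mat nr n" and B: "B \<in> carrier_mat n nc"
    and SA: "elements_mat A \<subseteq> S" and SB: "elements_mat B \<subseteq> S"
  shows "elements_mat (A * B) \<subseteq> S"
proof
  fix x assume "x \<in> elements_mat (A * B)"
  then obtain i j where ij: "i < nr" "j < nc" "x = (A * B) $$ (i, j)"
    using A B by (metis carrier_matD elements_matD index_mult_mat(2,3))
  have "A $$ (i, k) \<in> S" "B $$ (k, j) \<in> S" if "k < n" for k
    using that ij A B SA SB by blast+
  then show "x \<in> S"
    unfolding ij(3) index_mult_mat_sum[OF A B ij(1,2)] by (intro sum_mem_hom[THEN conjunct1] mult_mem) auto
qed

lemma map_mat_mult:
  assumes A: "A \<in> carrier_mat nr n" and B: "B \<in> carrier_mat n nc"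
    and SA: "elements_mat A \<subseteq> S" and SB: "elements_mat B \<subseteq> S"
  shows "map_mat h (A * B) = map_mat h A * map_mat h B"
proof (rule mat_eq_entries)
  fix i j assume ij: "i < nr" "j < nc"
  have mem: "A $$ (i, k) \<in> S" "B $$ (k, j) \<in> S" if "k < n" for k
    using that ij A B SA SB by blast+
  have "map_mat h (A * B) $$ (i, j) = h (\<Sum>k<n. A $$ (i, k) * B $$ (k, j))"
    using ij A B by (simp add: index_mult_mat_sum[OF A B] del: index_mult_mat(1))
  also have "\<dots> = (\<Sum>k<n. h (A $$ (i, k) * B $$ (k, j)))"
    using sum_mem_hom[of "{..<n}" "\<lambda>k. A $$ (i, k) * B $$ (k, j)"] mem mult_mem by simp
  also have "\<dots> = (\<Sum>k<n. map_mat h A $$ (i, k) * map_mat h B $$ (k, j))"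
    using A B ij mem by (intro sum.cong) (auto simp: hom_mult)
  also have "\<dots> = (map_mat h A * map_mat h B) $$ (i, j)"
    using A B ij by (subst index_mult_mat_sum[of _ nr n _ nc]) auto
  finally show "map_mat h (A * B) $$ (i, j) = (map_mat h A * map_mat h B) $$ (i, j)" .
qed (use A B in auto)

end

section \<open>Stable and proper matrices, evaluation and feedthrough\<close>

interpretation stable_hom: partial_hom "Collect rf_stable" "\<lambda>f. rf_eval f (cis \<omega>)" for \<omega>
  using rf_const_regular[of 0] rf_stable_const[of 0]
  by unfold_locales (auto simp: rf_stable_add rf_stable_mult rf_const_0
      intro!: rf_add_regular rf_mult_regular rf_stable_circle)

interpretation proper_hom: partial_hom "Collect rf_proper" rf_inf
  using rf_proper_const[of 0]
  by unfold_locales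
    (auto simp: rf_proper_add rf_proper_mult rf_inf_add rf_inf_mult rf_inf_0 rf_const_0)

interpretation cnj_hom: partial_hom UNIV cnj
  by unfold_locales auto

interpretation complex_of_real_hom: partial_hom UNIV complex_of_real
  by unfold_locales auto

lemma stable_matI:
  "A \<in> carrier_mat nr nc \<Longrightarrow> (\<And>i j. i < nr \<Longrightarrow> j < nc \<Longrightarrow> rf_stable (A $$ (i, j))) \<Longrightarrow> stable_mat A"
  unfolding stable_mat_def by (metis carrier_matD elements_matD)

lemma stable_matD:
  "stable_mat A \<Longrightarrow> A \<in> carrier_mat nr nc \<Longrightarrow> i < nr \<Longrightarrow> j < nc \<Longrightarrow> rf_stable (A $$ (i, j))"
  unfolding stable_mat_def by blast

lemma stable_mat_imp_proper_mat: "stable_mat A \<Longrightarrow> proper_mat A"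
  by (simp add: stable_mat_def proper_mat_def rf_stable_imp_proper)

lemma stable_mat_mult:
  "A \<in> carrier_mat nr n \<Longrightarrow> B \<in> carrier_mat n nc \<Longrightarrow> stable_mat A \<Longrightarrow> stable_mat B
    \<Longrightarrow> stable_mat (A * B)"
  using stable_hom.mult_mat_mem[of A nr n B nc] unfolding stable_mat_def by blast

lemma stable_mat_const: "stable_mat (map_mat rf_const A)"
  by (auto simp: stable_mat_def rf_stable_const)

lemma stable_mat_transpose: "stable_mat A \<Longrightarrow> stable_mat (transpose_mat A)"
  by (rule stable_matI[of _ "dim_col A" "dim_row A"]) (auto intro: stable_matD)

lemma stable_mat_one_minus:
  assumes G: "G \<in> carrier_mat n n" and "stable_mat G"
  shows "stable_mat (1\<^sub>m n - G)"
proof (rule stable_matI)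
  fix i j assume ij: "i < n" "j < n"
  \<comment> \<open>The entry of the identity matrix is written as a constant so that closure under
    differences applies.\<close>
  have "rf_stable (rf_const (if i = j then 1 else 0) - G $$ (i, j))"
    by (intro rf_stable_diff rf_stable_const stable_matD[OF assms(2) G] ij)
  then show "rf_stable ((1\<^sub>m n - G) $$ (i, j))"
    using G ij by (simp add: rf_const_0 rf_const_1 split: if_splits)
qed (use G in auto)

lemma mat_eval_circle_mult:
  "A \<in> carrier_mat nr n \<Longrightarrow> B \<in> carrier_mat n nc \<Longrightarrow> stable_mat A \<Longrightarrow> stable_mat B
    \<Longrightarrow> mat_eval (A * B) (cis \<omega>) = mat_eval A (cis \<omega>) * mat_eval B (cis \<omega>)"
  using stable_hom.map_mat_mult[of A nr n B nc] unfolding stable_mat_def mat_eval_def by blast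

lemma mat_eval_const: "mat_eval (map_mat rf_const A) z = map_mat of_real A"
  by (rule eq_matI) (simp_all add: mat_eval_def rf_const_regular)

lemma map_mat_rf_const_one: "map_mat rf_const (1\<^sub>m n) = 1\<^sub>m n"
  by (rule eq_matI) (auto simp: rf_const_0 rf_const_1)

lemma mat_eval_one: "mat_eval (1\<^sub>m n) z = 1\<^sub>m n"
  by (rule eq_matI) (use rf_const_regular(2)[of 0] rf_const_regular(2)[of 1] in
      \<open>auto simp: mat_eval_def rf_const_0 rf_const_1\<close>)

lemma mat_eval_carrier: "A \<in> carrier_mat nr nc \<Longrightarrow> mat_eval A z \<in> carrier_mat nr nc"
  by (simp add: mat_eval_def)

lemma stable_mat_eq_on_circle:
  assumes A: "A \<in> carrier_mat nr nc" "stable_mat A" and B: "B \<in> carrier_mat nr nc" "stable_mat B"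
    and eq: "\<And>\<omega>. mat_eval A (cis \<omega>) = mat_eval B (cis \<omega>)"
  shows "A = B"
proof (rule mat_eq_entries[OF A(1) B(1)], rule rf_eq_on_circle)
  fix i j \<omega> assume "i < nr" "j < nc"
  then show "rf_eval (A $$ (i, j)) (cis \<omega>) = rf_eval (B $$ (i, j)) (cis \<omega>)"
    using arg_cong[OF eq[of \<omega>], of "\<lambda>A. A $$ (i, j)"] A B by (simp add: mat_eval_def)
qed (use A B stable_matD in blast)+

lemma mat_inf_carrier: "A \<in> carrier_mat nr nc \<Longrightarrow> mat_inf A \<in> carrier_mat nr nc"
  by (simp add: mat_inf_def)

lemma mat_inf_mult:
  "A \<in> carrier_mat nr n \<Longrightarrow> B \<in> carrier_mat n nc \<Longrightarrow> proper_mat A \<Longrightarrow> proper_mat B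
    \<Longrightarrow> mat_inf (A * B) = mat_inf A * mat_inf B"
  using proper_hom.map_mat_mult[of A nr n B nc] unfolding proper_mat_def mat_inf_def by blast

lemma proper_mat_mult:
  "A \<in> carrier_mat nr n \<Longrightarrow> B \<in> carrier_mat n nc \<Longrightarrow> proper_mat A \<Longrightarrow> proper_mat B
    \<Longrightarrow> proper_mat (A * B)"
  using proper_hom.mult_mat_mem[of A nr n B nc] unfolding proper_mat_def by blast

lemma mat_inf_const: "mat_inf (map_mat rf_const A) = A"
  by (rule eq_matI) (simp_all add: mat_inf_def rf_inf_const)

lemma mat_inf_one_minus:
  assumes G: "G \<in> carrier_mat n n" and "proper_mat G"
  shows "mat_inf (1\<^sub>m n - G) = 1\<^sub>m n - mat_inf G"
proof (rule mat_eq_entries)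
  fix i j assume ij: "i < n" "j < n"
  then have "rf_proper (G $$ (i, j))"
    using assms unfolding proper_mat_def by blast
  then show "mat_inf (1\<^sub>m n - G) $$ (i, j) = (1\<^sub>m n - mat_inf G) $$ (i, j)"
    using G ij rf_proper_const[of 0] rf_proper_const[of 1]
    by (auto simp: mat_inf_def rf_inf_diff rf_const_0 rf_const_1 rf_inf_0 rf_inf_1)
qed (use G in \<open>auto simp: mat_inf_def\<close>)

section \<open>Adjoints and positive definite matrices\<close>

lemma mat_adjoint_complex: "mat_adjoint A = transpose_mat (map_mat cnj A)"
  by (rule eq_matI) (auto simp: mat_adjoint_def mat_of_rows_def conjugate_complex_def)

lemma mat_adjoint_mult:
  fixes A B :: "complex mat"
  assumes "A \<in> carrier_mat nr n" "B \<in> carrier_mat n nc"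
  shows "mat_adjoint (A * B) = mat_adjoint B * mat_adjoint A"
  using assms unfolding mat_adjoint_complex
  by (simp add: cnj_hom.map_mat_mult[of A nr n B nc] transpose_mult[of _ nr n _ nc])

lemma mat_adjoint_one: "mat_adjoint (1\<^sub>m n :: complex mat) = 1\<^sub>m n"
  unfolding mat_adjoint_complex by (rule eq_matI) auto

lemma mat_adjoint_carrier:
  "A \<in> carrier_mat nr nc \<Longrightarrow> mat_adjoint A \<in> carrier_mat nc nr" for A :: "complex mat"
  unfolding mat_adjoint_complex by simp

text \<open>A nonzero kernel vector would make the quadratic form vanish.\<close>

lemma pos_def_mat_has_inverse:
  assumes E: "E \<in> carrier_mat n n" and pd: "pos_def_mat E"
  obtains F where "F \<in> carrier_mat n n" "E * F = 1\<^sub>m n" "F * E = 1\<^sub>m n"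
proof -
  have "det E \<noteq> 0"
  proof
    assume "det E = 0"
    then obtain v where v: "v \<in> carrier_vec n" "v \<noteq> 0\<^sub>v n" "E *\<^sub>v v = 0\<^sub>v n"
      using det_0_iff_vec_prod_zero[OF E] by blast
    have "v \<bullet> (E *\<^sub>v v) > 0" using pd E v(1,2) by (simp add: pos_def_mat_def)
    then show False using v scalar_prod_right_zero[OF v(1)] by simp
  qed
  from det_non_zero_imp_unit[OF E this] show ?thesis
    using that by (auto simp: Units_def ring_mat_def)
qed

text \<open>A diagonal entry is the quadratic form at a unit vector.\<close>

lemma pos_def_mat_diag_pos:
  assumes E: "E \<in> carrier_mat n n" and pd: "pos_def_mat E" and i: "i < n"
  shows "E $$ (i, i) > 0"
proof -
  have "unit_vec n i \<noteq> (0\<^sub>v n :: real vec)"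
    using i by (metis index_unit_vec(1) index_zero_vec(1) zero_neq_one)
  then have "unit_vec n i \<bullet> (E *\<^sub>v unit_vec n i) > 0"
    using pd E by (simp add: pos_def_mat_def)
  then show ?thesis
    using E i by (simp add: scalar_prod_left_unit[of _ n] mult_mat_vec_def scalar_prod_right_unit)
qed

subsection \<open>Uniqueness of spectral factors up to a constant matrix\<close>

text \<open>The algebra at a single frequency: the left inverses cancel one factor on each side of
  the equality of spectra. The first conclusion is what will make \<open>v0 * w1\<close> conjugate
  to a stable matrix, the second recovers \<open>w1\<close> from it, and the third relates the
  covariances.\<close>

lemma factor_pointwise:
  fixes w0 w1 v0 v1 e0 e1 f1 :: "complex mat"
  assumes c: "w0 \<in> carrier_mat L p" "w1 \<in> carrier_mat L p" "v0 \<in> carrier_mat p L"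
      "v1 \<in> carrier_mat p L" "e0 \<in> carrier_mat p p" "e1 \<in> carrier_mat p p" "f1 \<in> carrier_mat p p"
    and v0w0: "v0 * w0 = 1\<^sub>m p" and v1w1: "v1 * w1 = 1\<^sub>m p" and e1f1: "e1 * f1 = 1\<^sub>m p"
    and eq: "w1 * e1 * mat_adjoint w1 = w0 * e0 * mat_adjoint w0"
  shows "v0 * w1 = e0 * mat_adjoint (v1 * w0) * f1"
    and "w0 * (v0 * w1) = w1"
    and "(v0 * w1) * e1 * mat_adjoint (v0 * w1) = e0"
proof -
  note adj = mat_adjoint_carrier[OF c(1)] mat_adjoint_carrier[OF c(2)]
    mat_adjoint_carrier[OF c(3)] mat_adjoint_carrier[OF c(4)]
  note dims = carrier_matD[OF c(1)] carrier_matD[OF c(2)] carrier_matD[OF c(3)]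
    carrier_matD[OF c(4)] carrier_matD[OF c(5)] carrier_matD[OF c(6)] carrier_matD[OF c(7)]
    carrier_matD[OF adj(1)] carrier_matD[OF adj(2)] carrier_matD[OF adj(3)] carrier_matD[OF adj(4)]
  have a0: "mat_adjoint w0 * mat_adjoint v0 = 1\<^sub>m p"
    using mat_adjoint_mult[OF c(3,1)] by (simp add: v0w0 mat_adjoint_one)
  have a1: "mat_adjoint w1 * mat_adjoint v1 = 1\<^sub>m p"
    using mat_adjoint_mult[OF c(4,2)] by (simp add: v1w1 mat_adjoint_one)
  have ay: "mat_adjoint (v1 * w0) = mat_adjoint w0 * mat_adjoint v1"
    by (rule mat_adjoint_mult[OF c(4,1)])
  have ax: "mat_adjoint (v0 * w1) = mat_adjoint w1 * mat_adjoint v0"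
    by (rule mat_adjoint_mult[OF c(3,2)])
  \<comment> \<open>\<open>v0\<close> cancels \<open>w0\<close> from the left.\<close>
  have i: "v0 * (w1 * (e1 * mat_adjoint w1)) = e0 * mat_adjoint w0"
  proof -
    have "v0 * (w1 * (e1 * mat_adjoint w1)) = v0 * (w0 * (e0 * mat_adjoint w0))"
      using eq by (simp add: mat_mult_assoc_dim dims)
    also have "\<dots> = e0 * mat_adjoint w0"
      by (rule mat_mult_left_cancel[OF v0w0 c(3,1)]) (use c adj in auto)
    finally show ?thesis .
  qed
  \<comment> \<open>The adjoint of \<open>v1\<close> cancels that of \<open>w1\<close> from the
    right.\<close>
  have ii: "v0 * (w1 * e1) = e0 * (mat_adjoint w0 * mat_adjoint v1)"
  proof -
    have "v0 * (w1 * e1) = v0 * (w1 * (e1 * (mat_adjoint w1 * mat_adjoint v1)))"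
      using a1 c by simp
    also have "\<dots> = v0 * (w1 * (e1 * mat_adjoint w1)) * mat_adjoint v1"
      by (simp add: mat_mult_assoc_dim dims)
    also have "\<dots> = e0 * (mat_adjoint w0 * mat_adjoint v1)"
      unfolding i by (simp add: mat_mult_assoc_dim dims)
    finally show ?thesis .
  qed
  have "v0 * w1 = v0 * (w1 * (e1 * f1))"
    using c e1f1 by simp
  also have "\<dots> = v0 * (w1 * e1) * f1"
    by (simp add: mat_mult_assoc_dim dims)
  finally have x: "v0 * w1 = e0 * (mat_adjoint w0 * mat_adjoint v1) * f1"
    unfolding ii .
  then show "v0 * w1 = e0 * mat_adjoint (v1 * w0) * f1"
    unfolding ay .
  \<comment> \<open>Substituting the formula for \<open>v0 * w1\<close> makes the spectrum of the
    first factor reappear, and it can be replaced by that of the second.\<close>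
  have "w0 * (v0 * w1) = (w0 * e0 * mat_adjoint w0) * (mat_adjoint v1 * f1)"
    unfolding x by (simp add: mat_mult_assoc_dim dims)
  also have "\<dots> = w1 * (e1 * (mat_adjoint w1 * (mat_adjoint v1 * f1)))"
    unfolding eq[symmetric] by (simp add: mat_mult_assoc_dim dims)
  also have "mat_adjoint w1 * (mat_adjoint v1 * f1) = f1"
    by (rule mat_mult_left_cancel[OF a1 adj(2,4) c(7)])
  finally show "w0 * (v0 * w1) = w1"
    using c e1f1 by simp
  have "(v0 * w1) * e1 * mat_adjoint (v0 * w1) = v0 * (w1 * (e1 * mat_adjoint w1)) * mat_adjoint v0"
    unfolding ax by (simp add: mat_mult_assoc_dim dims)
  also have "\<dots> = e0 * (mat_adjoint w0 * mat_adjoint v0)"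
    unfolding i by (simp add: mat_mult_assoc_dim dims)
  finally show "(v0 * w1) * e1 * mat_adjoint (v0 * w1) = e0"
    using a0 c by simp
qed

text \<open>The quotient \<open>Y = V0 * W1\<close> is stable, and on the circle it is the entrywise
  conjugate of another stable matrix \<open>Z\<close>; by \<open>rf_stable_conj_stable_const\<close>
  each entry is constant.\<close>

lemma spectral_factor_unique:
  assumes W0: "W0 \<in> carrier_mat L p" "stable_mat W0" and W1: "W1 \<in> carrier_mat L p" "stable_mat W1"
    and V0: "V0 \<in> carrier_mat p L" "stable_mat V0" "V0 * W0 = 1\<^sub>m p"
    and V1: "V1 \<in> carrier_mat p L" "stable_mat V1" "V1 * W1 = 1\<^sub>m p"
    and E0: "E0 \<in> carrier_mat p p" and E1: "E1 \<in> carrier_mat p p" "pos_def_mat E1"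
    and eq: "\<And>\<omega>. mat_eval W1 (cis \<omega>) * map_mat complex_of_real E1 * mat_adjoint (mat_eval W1 (cis \<omega>))
      = mat_eval W0 (cis \<omega>) * map_mat complex_of_real E0 * mat_adjoint (mat_eval W0 (cis \<omega>))"
  obtains X where "X \<in> carrier_mat p p" "W1 = W0 * map_mat rf_const X"
    "X * E1 * transpose_mat X = E0"
proof -
  obtain F1 where F1: "F1 \<in> carrier_mat p p" "E1 * F1 = 1\<^sub>m p"
    using pos_def_mat_has_inverse[OF E1] by blast
  define Y where "Y = V0 * W1"
  \<comment> \<open>On the circle \<open>Y\<close> is \<open>E0\<close> times the adjoint of
    \<open>V1 * W0\<close> times \<open>F1\<close>. Entrywise conjugation fixes the real factors and
    turns the adjoint into a transpose, which leaves a stable rational matrix.\<close>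
  define Z where "Z = map_mat rf_const E0 * transpose_mat (V1 * W0) * map_mat rf_const F1"
  have Y: "Y \<in> carrier_mat p p" "stable_mat Y"
    unfolding Y_def using stable_mat_mult[OF V0(1) W1(1) V0(2) W1(2)] V0 W1 by auto
  have VW: "V1 * W0 \<in> carrier_mat p p" "stable_mat (V1 * W0)"
    using stable_mat_mult[OF V1(1) W0(1) V1(2) W0(2)] V1 W0 by auto
  have E0Y: "map_mat rf_const E0 * transpose_mat (V1 * W0) \<in> carrier_mat p p"
      "stable_mat (map_mat rf_const E0 * transpose_mat (V1 * W0))"
    using VW E0 stable_mat_mult[of "map_mat rf_const E0" p p "transpose_mat (V1 * W0)" p]
    by (auto simp: stable_mat_const stable_mat_transpose)
  have Z: "Z \<in> carrier_mat p p" "stable_mat Z"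
    unfolding Z_def using E0Y F1 stable_mat_mult[OF E0Y(1) _ E0Y(2), of "map_mat rf_const F1" p]
    by (auto simp: stable_mat_const)
  have one: "map_mat complex_of_real (1\<^sub>m p) = 1\<^sub>m p"
    by (rule eq_matI) auto
  have e1f1: "map_mat complex_of_real E1 * map_mat complex_of_real F1 = 1\<^sub>m p"
    using complex_of_real_hom.map_mat_mult[OF E1(1) F1(1)] F1 one by simp
  have Vw0: "mat_eval V0 (cis \<omega>) * mat_eval W0 (cis \<omega>) = 1\<^sub>m p" for \<omega>
    using mat_eval_circle_mult[OF V0(1) W0(1) V0(2) W0(2), of \<omega>] by (simp add: V0 mat_eval_one)
  have Vw1: "mat_eval V1 (cis \<omega>) * mat_eval W1 (cis \<omega>) = 1\<^sub>m p" for \<omega>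
    using mat_eval_circle_mult[OF V1(1) W1(1) V1(2) W1(2), of \<omega>] by (simp add: V1 mat_eval_one)
  have evY: "mat_eval Y (cis \<omega>) = mat_eval V0 (cis \<omega>) * mat_eval W1 (cis \<omega>)" for \<omega>
    unfolding Y_def by (rule mat_eval_circle_mult[OF V0(1) W1(1) V0(2) W1(2)])
  have evVW: "mat_eval (V1 * W0) (cis \<omega>) = mat_eval V1 (cis \<omega>) * mat_eval W0 (cis \<omega>)" for \<omega>
    by (rule mat_eval_circle_mult[OF V1(1) W0(1) V1(2) W0(2)])
  have carr: "map_mat complex_of_real E0 \<in> carrier_mat p p"
    "map_mat complex_of_real E1 \<in> carrier_mat p p" "map_mat complex_of_real F1 \<in> carrier_mat p p"
    using E0 E1 F1 by auto
  note pw = factor_pointwise[OF mat_eval_carrier[OF W0(1)] mat_eval_carrier[OF W1(1)]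
      mat_eval_carrier[OF V0(1)] mat_eval_carrier[OF V1(1)] carr Vw0 Vw1 e1f1 eq,
      folded evY evVW]
  have cnj_real: "map_mat cnj (map_mat complex_of_real E) = map_mat complex_of_real E" for E
    by (rule eq_matI) auto
  have YZ: "mat_eval Y (cis \<omega>) = map_mat cnj (mat_eval Z (cis \<omega>))" for \<omega>
  proof -
    have tr: "mat_eval (transpose_mat (V1 * W0)) (cis \<omega>) = transpose_mat (mat_eval (V1 * W0) (cis \<omega>))"
      unfolding mat_eval_def by (rule eq_matI) auto
    have "mat_eval Z (cis \<omega>) = map_mat complex_of_real E0 *
        transpose_mat (mat_eval (V1 * W0) (cis \<omega>)) * map_mat complex_of_real F1"
    proof -
      have "mat_eval Z (cis \<omega>) =
          mat_eval (map_mat rf_const E0 * transpose_mat (V1 * W0)) (cis \<omega>)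
            * mat_eval (map_mat rf_const F1) (cis \<omega>)"
        unfolding Z_def using F1 by (intro mat_eval_circle_mult[OF E0Y(1) _ E0Y(2) stable_mat_const]) auto
      also have "mat_eval (map_mat rf_const E0 * transpose_mat (V1 * W0)) (cis \<omega>)
          = mat_eval (map_mat rf_const E0) (cis \<omega>) * mat_eval (transpose_mat (V1 * W0)) (cis \<omega>)"
        using E0 VW by (intro mat_eval_circle_mult stable_mat_const stable_mat_transpose) auto
      finally show ?thesis by (simp add: mat_eval_const tr)
    qed
    also have "map_mat cnj \<dots> = map_mat complex_of_real E0 * mat_adjoint (mat_eval (V1 * W0) (cis \<omega>))
        * map_mat complex_of_real F1"
    proof -
      have "map_mat cnj (transpose_mat (mat_eval (V1 * W0) (cis \<omega>)))
          = mat_adjoint (mat_eval (V1 * W0) (cis \<omega>))"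
        unfolding mat_adjoint_complex by (rule eq_matI) auto
      then show ?thesis
        using mat_eval_carrier[OF VW(1)] E0 F1
        by (simp add: cnj_hom.map_mat_mult[of _ p p _ p] cnj_real)
    qed
    finally show ?thesis using pw(1) by simp
  qed
  have "\<exists>c. Y $$ (i, j) = rf_const c" if ij: "i < p" "j < p" for i j
  proof (rule rf_stable_conj_stable_const)
    show "rf_stable (Y $$ (i, j))" "rf_stable (Z $$ (i, j))"
      using Y Z ij stable_matD by blast+
    show "rf_eval (Y $$ (i, j)) (cis \<omega>) = cnj (rf_eval (Z $$ (i, j)) (cis \<omega>))" for \<omega>
      using arg_cong[OF YZ[of \<omega>], of "\<lambda>A. A $$ (i, j)"] ij Y Z by (simp add: mat_eval_def)
  qed
  \<comment> \<open>A constant is its own value at infinity, so \<open>mat_inf\<close> collects all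
    the constants into one real matrix.\<close>
  then have YX: "Y = map_mat rf_const (mat_inf Y)"
    using Y by (intro mat_eq_entries[OF Y(1)]) (auto simp: mat_inf_def, metis rf_inf_const)
  define X where "X = mat_inf Y"
  have X: "X \<in> carrier_mat p p" using Y by (simp add: X_def mat_inf_def)
  show ?thesis
  proof
    show "X \<in> carrier_mat p p" by fact
    have "W0 * Y = W1"
    proof (rule stable_mat_eq_on_circle)
      show "W0 * Y \<in> carrier_mat L p" using W0 Y by auto
      show "stable_mat (W0 * Y)" using stable_mat_mult[OF W0(1) Y(1) W0(2) Y(2)] .
      show "mat_eval (W0 * Y) (cis \<omega>) = mat_eval W1 (cis \<omega>)" for \<omega>
        using pw(2) by (simp add: mat_eval_circle_mult[OF W0(1) Y(1) W0(2) Y(2)])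
    qed (use W1 in auto)
    then show "W1 = W0 * map_mat rf_const X"
      using YX X_def by simp
    \<comment> \<open>Any point of the circle would serve, since \<open>Y\<close> is
      constant.\<close>
    have x: "mat_eval Y (cis 0) = map_mat complex_of_real X"
      using YX by (metis X_def mat_eval_const)
    have "mat_adjoint (map_mat complex_of_real X) = map_mat complex_of_real (transpose_mat X)"
      unfolding mat_adjoint_complex by (rule eq_matI) auto
    with pw(3)[of 0] have "map_mat complex_of_real X * map_mat complex_of_real E1
        * map_mat complex_of_real (transpose_mat X) = map_mat complex_of_real E0"
      unfolding x by simp
    then have "map_mat complex_of_real (X * E1 * transpose_mat X) = map_mat complex_of_real E0"
      using X E1 by (simp add: complex_of_real_hom.map_mat_mult[of _ p p _ p])
    then show "X * E1 * transpose_mat X = E0"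
      by (rule of_real_hom.mat_hom_inj)
  qed
qed

subsection \<open>Linear algebra\<close>

text \<open>\<open>minv\<close> is specified only if \<open>mat_inverse\<close> returns a value;
  invertibility makes \<open>A\<close> a unit of the matrix ring, which excludes
  \<open>None\<close>.\<close>

lemma minv_inverse:
  assumes A: "A \<in> carrier_mat n n" and inv: "invertible_mat A"
  shows "minv A \<in> carrier_mat n n" "A * minv A = 1\<^sub>m n" "minv A * A = 1\<^sub>m n"
proof -
  obtain B where B: "A * B = 1\<^sub>m (dim_row A)" "B * A = 1\<^sub>m (dim_row B)"
    using inv unfolding invertible_mat_def inverts_mat_def by blast
  \<comment> \<open>The dimensions of \<open>B\<close> are read off from those of the two
    products.\<close>
  have "B \<in> carrier_mat n n"
    using arg_cong[OF B(1), of dim_col] arg_cong[OF B(2), of dim_col] A by auto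
  then have "A \<in> Units (ring_mat TYPE('a) n ())"
    using A B by (auto simp: Units_def ring_mat_def)
  then obtain C where C: "mat_inverse A = Some C"
    using mat_inverse(1)[OF A] by fastforce
  from mat_inverse(2)[OF A C]
  show "minv A \<in> carrier_mat n n" "A * minv A = 1\<^sub>m n" "minv A * A = 1\<^sub>m n"
    by (simp_all add: minv_def C)
qed

text \<open>Rank \<open>n\<close> provides \<open>n\<close> independent columns. They form a
  nonsingular square matrix, whose left kernel contains \<open>u\<close>.\<close>

lemma (in vec_space) full_rank_left_kernel:
  assumes A: "A \<in> carrier_mat n nc" and rank: "rank A = n"
    and ker: "\<And>k. k < nc \<Longrightarrow> (\<Sum>j<n. u j * A $$ (j, k)) = 0" and j: "j < n"
  shows "u j = 0"
proof -
  \<comment> \<open>The rank is the size of a maximal independent set of columns.\<close>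
  obtain S where S: "maximal S (\<lambda>T. T \<subseteq> set (cols A) \<and> lin_indpt T)"
    using maximal_exists_superset[of "set (cols A)" "\<lambda>T. T \<subseteq> set (cols A) \<and> lin_indpt T" "{}"]
      finite_lin_indpt2[of "{}"] by auto
  then have S_cols: "S \<subseteq> set (cols A)" and indpt: "lin_indpt S"
    by (auto simp: maximal_def)
  have card: "card S = n"
    using rank_card_indpt[OF A S] rank by simp
  obtain xs where xs: "set xs = S" "distinct xs"
    using finite_distinct_list[OF finite_subset[OF S_cols]] by auto
  then have len: "length xs = n"
    using card distinct_card by fastforce
  have S_carrier: "S \<subseteq> carrier_vec n"
    using S_cols cols_dim[of A] A by auto
  define B where "B = mat_of_cols n xs"
  have B: "B \<in> carrier_mat n n" using len by (auto simp: B_def)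
  have colsB: "cols B = xs"
    unfolding B_def using S_carrier xs by (intro cols_mat_of_cols) auto
  have "rank B = n"
    using lin_indpt_full_rank[OF B] colsB xs indpt by simp
  then have "det (transpose_mat B) \<noteq> 0"
    using det_rank_iff[OF B] det_transpose[OF B] by simp
  moreover have "transpose_mat B *\<^sub>v vec n u = 0\<^sub>v n"
  proof (rule eq_vecI)
    fix i assume "i < dim_vec (0\<^sub>v n :: 'a vec)"
    then have i: "i < n" by simp
    then have "col B i \<in> set (cols A)"
      using colsB S_cols xs(1) B by (metis carrier_matD(2) cols_length cols_nth nth_mem subsetD)
    then obtain k where k: "k < nc" "col B i = col A k"
      using A by (metis carrier_matD(2) cols_length cols_nth in_set_conv_nth)
    have "(transpose_mat B *\<^sub>v vec n u) $ i = col B i \<bullet> vec n u"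
      using i B by simp
    also have "\<dots> = (\<Sum>j<n. u j * A $$ (j, k))"
      unfolding k(2) scalar_prod_def using A k(1)
      by (auto simp: atLeast0LessThan mult.commute intro!: sum.cong)
    finally show "(transpose_mat B *\<^sub>v vec n u) $ i = 0\<^sub>v n $ i"
      using ker k(1) i by simp
  qed (use B in auto)
  moreover have "vec n u \<in> carrier_vec n" by (rule carrier_vecI) simp
  ultimately have "vec n u = 0\<^sub>v n"
    using det_0_iff_vec_prod_zero_field[OF transpose_carrier_mat[THEN iffD2, OF B]] by blast
  then show ?thesis
    using j by (metis index_vec index_zero_vec(1))
qed

text \<open>Reindexing along \<open>pick I\<close> carries the kernel criterion over to submatrices,
  the form in which (C3) provides full row rank.\<close>

lemma full_row_rank_submatrix_left_kernel:
  fixes A :: "'a :: field mat"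
  assumes A: "A \<in> carrier_mat nr nc" and I: "I \<subseteq> {..<nr}" and J: "J \<subseteq> {..<nc}"
    and rank: "full_row_rank (submatrix A I J)"
    and ker: "\<And>k. k \<in> J \<Longrightarrow> (\<Sum>j\<in>I. u j * A $$ (j, k)) = 0" and j: "j \<in> I"
  shows "u j = 0"
proof -
  have fin: "finite I" "finite J" using I J finite_subset by auto
  have sets: "{i. i < nr \<and> i \<in> I} = I" "{k. k < nc \<and> k \<in> J} = J" using I J by auto
  have sub: "submatrix A I J \<in> carrier_mat (card I) (card J)"
    using dim_submatrix[of A I J] A sets by auto
  have ent: "submatrix A I J $$ (a, b) = A $$ (pick I a, pick J b)"
    if "a < card I" "b < card J" for a b
    using submatrix_index[of a A I b J] that A sets by simp
  have "inj_on (pick I) {..<card I}"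
  proof (rule linorder_inj_onI')
    fix a b assume "b \<in> {..<card I}" "a < b"
    then show "pick I a \<noteq> pick I b"
      using pick_mono[of b I a] by simp
  qed
  moreover have "pick I ` {..<card I} = I"
  proof
    show "pick I ` {..<card I} \<subseteq> I" using pick_in_set by auto
    show "I \<subseteq> pick I ` {..<card I}"
    proof
      fix i assume i: "i \<in> I"
      \<comment> \<open>\<open>pick\<close> enumerates \<open>I\<close> increasingly, so the
        position of \<open>i\<close> is the number of smaller elements.\<close>
      have "card {a \<in> I. a < i} < card I"
        using i fin by (intro psubset_card_mono) auto
      then show "i \<in> pick I ` {..<card I}"
        by (intro image_eqI[where x = "card {a \<in> I. a < i}"]) (simp_all add: pick_card_in_set[OF i])
    qed
  qed
  ultimately have bij: "bij_betw (pick I) {..<card I} I"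
    by (simp add: bij_betw_def)
  have "(\<Sum>a<card I. u (pick I a) * submatrix A I J $$ (a, b)) = 0" if b: "b < card J" for b
  proof -
    have "(\<Sum>a<card I. u (pick I a) * submatrix A I J $$ (a, b))
        = (\<Sum>a<card I. u (pick I a) * A $$ (pick I a, pick J b))"
      using b by (intro sum.cong) (auto simp: ent)
    also have "\<dots> = (\<Sum>i\<in>I. u i * A $$ (i, pick J b))"
      by (rule sum.reindex_bij_betw[OF bij])
    also have "\<dots> = 0"
      using ker pick_in_set[of b J] b by auto
    finally show ?thesis .
  qed
  moreover have "vec_space.rank (card I) (submatrix A I J) = card I"
    using rank sub by (simp add: full_row_rank_def)
  moreover obtain a where a: "a < card I" "pick I a = j"
    using bij j by (metis bij_betw_iff_bijections lessThan_iff)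
  ultimately have "u (pick I a) = 0"
    using vec_space.full_rank_left_kernel[OF sub, of "\<lambda>a. u (pick I a)" a] by blast
  then show ?thesis using a by simp
qed

text \<open>A zero on the diagonal makes the whole row zero, which puts a unit vector into the left
  kernel.\<close>

lemma diagonal_mat_full_rank_nonzero:
  fixes D :: "'a :: field mat"
  assumes D: "D \<in> carrier_mat n n" and diag: "diagonal_mat D"
    and rank: "vec_space.rank n D = n" and i: "i < n"
  shows "D $$ (i, i) \<noteq> 0"
proof
  assume 0: "D $$ (i, i) = 0"
  have "(\<Sum>j<n. (if j = i then 1 else 0) * D $$ (j, k)) = 0" if k: "k < n" for k
    using diag D 0 i k by (intro sum.neutral) (auto simp: diagonal_mat_def)
  from vec_space.full_rank_left_kernel[OF D rank this i] show False by simp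
qed

section \<open>Matrices placed side by side\<close>

lemma append_cols_carrier:
  "A \<in> carrier_mat n a \<Longrightarrow> B \<in> carrier_mat n b \<Longrightarrow> append_cols A B \<in> carrier_mat n (a + b)"
  by (auto simp: append_cols_def)

lemma index_append_cols:
  "A \<in> carrier_mat n a \<Longrightarrow> B \<in> carrier_mat n b \<Longrightarrow> i < n \<Longrightarrow> j < a + b
    \<Longrightarrow> append_cols A B $$ (i, j) = (if j < a then A $$ (i, j) else B $$ (i, j - a))"
  by (auto simp: append_cols_def)

lemma mult_append_cols:
  fixes A B C :: "'a :: semiring_0 mat"
  assumes C: "C \<in> carrier_mat m n" and A: "A \<in> carrier_mat n a" and B: "B \<in> carrier_mat n b"
  shows "C * append_cols A B = append_cols (C * A) (C * B)"
proof (rule mat_eq_entries)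
  note AB = append_cols_carrier[OF A B]
  have CA: "C * A \<in> carrier_mat m a" and CB: "C * B \<in> carrier_mat m b"
    using A B C by auto
  show "C * append_cols A B \<in> carrier_mat m (a + b)" using C AB by auto
  show "append_cols (C * A) (C * B) \<in> carrier_mat m (a + b)"
    by (rule append_cols_carrier[OF CA CB])
  fix i j assume ij: "i < m" "j < a + b"
  show "(C * append_cols A B) $$ (i, j) = append_cols (C * A) (C * B) $$ (i, j)"
  proof (cases "j < a")
    case True
    then show ?thesis
      unfolding index_append_cols[OF CA CB ij] index_mult_mat_sum[OF C AB ij]
      by (simp add: index_mult_mat_sum[OF C A] ij index_append_cols[OF A B] del: index_mult_mat(1))
  next
    case False
    then show ?thesis
      unfolding index_append_cols[OF CA CB ij] index_mult_mat_sum[OF C AB ij]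
      using ij by (simp add: index_mult_mat_sum[OF C B] index_append_cols[OF A B] del: index_mult_mat(1))
  qed
qed

lemma append_cols_inject:
  assumes A: "A \<in> carrier_mat n a" "A' \<in> carrier_mat n a"
    and B: "B \<in> carrier_mat n b" "B' \<in> carrier_mat n b"
    and eq: "append_cols A B = append_cols A' B'"
  shows "A = A'" "B = B'"
proof -
  have ent: "append_cols A B $$ (i, j) = append_cols A' B' $$ (i, j)" for i j
    using eq by simp
  show "A = A'"
  proof (rule mat_eq_entries[OF A])
    show "A $$ (i, j) = A' $$ (i, j)" if "i < n" "j < a" for i j
      using ent[of i j] that by (simp add: index_append_cols[OF A(1) B(1)] index_append_cols[OF A(2) B(2)])
  qed
  show "B = B'"
  proof (rule mat_eq_entries[OF B])
    show "B $$ (i, j) = B' $$ (i, j)" if "i < n" "j < b" for i j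
      using ent[of i "a + j"] that
      by (simp add: index_append_cols[OF A(1) B(1)] index_append_cols[OF A(2) B(2)])
  qed
qed

section \<open>Identity top blocks, triangularity and diagonal congruence\<close>

text \<open>Reads \<open>X\<close> off a product whose left factor starts with identity rows, as the
  feedthrough of \<open>H\<close> does.\<close>

lemma identity_top_mult:
  fixes A X :: "'a :: semiring_1 mat"
  assumes A: "A \<in> carrier_mat n p" and X: "X \<in> carrier_mat p m" and "p \<le> n"
    and top: "\<And>i j. i < p \<Longrightarrow> j < p \<Longrightarrow> A $$ (i, j) = (if i = j then 1 else 0)"
    and ij: "i < p" "j < m"
  shows "(A * X) $$ (i, j) = X $$ (i, j)"
proof -
  have "(A * X) $$ (i, j) = (\<Sum>k<p. (if k = i then 1 else 0) * X $$ (k, j))"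
    unfolding index_mult_mat_sum[OF A X less_le_trans[OF ij(1) \<open>p \<le> n\<close>] ij(2)]
    using ij by (intro sum.cong) (auto simp: top)
  also have "\<dots> = (\<Sum>k<p. if k = i then X $$ (k, j) else 0)"
    by (intro sum.cong) auto
  finally show ?thesis using ij by simp
qed

text \<open>\<open>X\<close> is orthogonal up to diagonal scalings, so its inverse is both upper and lower triangular
  with respect to the order given by \<open>\<sigma>\<close>; the induction descends along \<open>\<sigma>\<close>.\<close>

lemma unitriangular_congruence_diagonal:
  fixes X :: "real mat"
  assumes X: "X \<in> carrier_mat p p" and E: "E \<in> carrier_mat p p"
    and E_diag: "\<And>i j. i < p \<Longrightarrow> j < p \<Longrightarrow> i \<noteq> j \<Longrightarrow> E $$ (i, j) = 0"
    and E_pos: "\<And>i. i < p \<Longrightarrow> E $$ (i, i) > 0"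
    and diag: "\<And>i j. i < p \<Longrightarrow> j < p \<Longrightarrow> i \<noteq> j \<Longrightarrow> (X * E * transpose_mat X) $$ (i, j) = 0"
    and unit: "\<And>i. i < p \<Longrightarrow> X $$ (i, i) = 1"
    and tri: "\<And>i j. i < p \<Longrightarrow> j < p \<Longrightarrow> i \<noteq> j \<Longrightarrow> \<not> \<sigma> i < (\<sigma> j :: nat) \<Longrightarrow> X $$ (i, j) = 0"
  shows "X = 1\<^sub>m p"
proof -
  have XE: "(X * E) $$ (i, k) = X $$ (i, k) * E $$ (k, k)" if "i < p" "k < p" for i k
  proof -
    have "(X * E) $$ (i, k) = (\<Sum>l<p. X $$ (i, l) * E $$ (l, k))"
      by (rule index_mult_mat_sum[OF X E that])
    also have "\<dots> = (\<Sum>l<p. if l = k then X $$ (i, k) * E $$ (k, k) else 0)"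
      using that E_diag by (intro sum.cong) auto
    finally show ?thesis using that by simp
  qed
  have ent: "(X * E * transpose_mat X) $$ (i, j) = (\<Sum>k<p. X $$ (i, k) * E $$ (k, k) * X $$ (j, k))"
    if "i < p" "j < p" for i j
    using that X E XE index_mult_mat_sum[of "X * E" p p "transpose_mat X" p i j]
    by (simp del: index_mult_mat(1))
  \<comment> \<open>Inserting 0 keeps the argument of \<open>Max\<close> nonempty when
    \<open>p\<close> is 0.\<close>
  define N where "N = Max (insert 0 (\<sigma> ` {..<p}))"
  have N: "\<sigma> j \<le> N" if "j < p" for j
    using that by (simp add: N_def)
  have "X $$ (i, j) = 0" if "i < p" "j < p" "i \<noteq> j" for i j
    using that
  proof (induction "N - \<sigma> j" arbitrary: i j rule: less_induct)
    case less
    \<comment> \<open>In the sum for entry \<open>(i, j)\<close> only \<open>k = j\<close> survives: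
      row \<open>j\<close> of \<open>X\<close> vanishes at larger \<sigma> by induction, and
      elsewhere off the diagonal by triangularity.\<close>
    have "(\<Sum>k<p. X $$ (i, k) * E $$ (k, k) * X $$ (j, k))
        = (\<Sum>k<p. if k = j then X $$ (i, j) * E $$ (j, j) else 0)"
    proof (intro sum.cong refl)
      fix k assume "k \<in> {..<p}"
      then have k: "k < p" by simp
      have "X $$ (j, k) = 0" if "k \<noteq> j"
      proof (cases "\<sigma> j < \<sigma> k")
        case True
        then have "N - \<sigma> k < N - \<sigma> j" using N[OF k] by simp
        from less.hyps[OF this \<open>j < p\<close> k] that show ?thesis by simp
      next
        case False
        then show ?thesis using tri[OF \<open>j < p\<close> k] that by simp
      qed
      then show "X $$ (i, k) * E $$ (k, k) * X $$ (j, k)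
          = (if k = j then X $$ (i, j) * E $$ (j, j) else 0)"
        using unit[OF \<open>j < p\<close>] by auto
    qed
    with diag[OF less.prems] ent[OF less.prems(1,2)] have "X $$ (i, j) * E $$ (j, j) = 0"
      using less.prems by simp
    then show ?case using E_pos[OF \<open>j < p\<close>] by simp
  qed
  then show ?thesis
    using X unit by (intro mat_eq_entries[OF X]) auto
qed

text \<open>Back substitution along \<sigma>: in \<open>W = E + G * W\<close>, row \<open>i\<close>
  of \<open>G\<close> reaches only rows of larger \<sigma>, which the induction has already
  treated.\<close>

lemma unitriangular_solution:
  fixes G W :: "'a :: ring_1 mat"
  assumes G: "G \<in> carrier_mat n n" and W: "W \<in> carrier_mat n p" and "p \<le> n"
    and strict: "\<And>i j. i < n \<Longrightarrow> j < n \<Longrightarrow> \<not> \<sigma> i < (\<sigma> j :: nat) \<Longrightarrow> G $$ (i, j) = 0"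
    and inj: "inj_on \<sigma> {..<n}"
    and eq: "\<And>i j. i < n \<Longrightarrow> j < p \<Longrightarrow> ((1\<^sub>m n - G) * W) $$ (i, j) = E i j"
    and E: "\<And>i j. i < n \<Longrightarrow> j < p \<Longrightarrow> i = j \<or> \<sigma> j < \<sigma> i \<Longrightarrow> E i j = (if i = j then 1 else 0)"
  shows "i < n \<Longrightarrow> j < p \<Longrightarrow> \<not> \<sigma> i < \<sigma> j \<Longrightarrow> W $$ (i, j) = (if i = j then 1 else 0)"
proof (induction "Max (insert 0 (\<sigma> ` {..<n})) - \<sigma> i" arbitrary: i rule: less_induct)
  case less
  have "(\<Sum>k<n. G $$ (i, k) * W $$ (k, j)) = 0"
  proof (rule sum.neutral, rule ballI)
    fix k assume "k \<in> {..<n}"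
    then have k: "k < n" by simp
    have max: "\<sigma> k \<le> Max (insert 0 (\<sigma> ` {..<n}))" using k by simp
    show "G $$ (i, k) * W $$ (k, j) = 0"
    proof (cases "\<sigma> i < \<sigma> k")
      case True
      with max have "Max (insert 0 (\<sigma> ` {..<n})) - \<sigma> k < Max (insert 0 (\<sigma> ` {..<n})) - \<sigma> i"
        by linarith
      \<comment> \<open>Here \<sigma> k exceeds \<sigma> i, which is at least \<sigma> j; hence k
        differs from j and the entry of \<open>W\<close> is 0.\<close>
      from less.hyps[OF this k less.prems(2)] True less.prems(3) show ?thesis by auto
    next
      case False
      then show ?thesis using strict[OF less.prems(1) k] by simp
    qed
  qed
  moreover have "(1\<^sub>m n - G) * W = W - G * W"
    using G W minus_mult_distrib_mat[of "1\<^sub>m n" n n G W p] by simp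
  then have "((1\<^sub>m n - G) * W) $$ (i, j) = W $$ (i, j) - (\<Sum>k<n. G $$ (i, k) * W $$ (k, j))"
    using less.prems G W by (simp add: index_mult_mat_sum[OF G W] del: index_mult_mat(1))
  ultimately have "W $$ (i, j) = E i j"
    using eq[OF less.prems(1,2)] by simp
  moreover have "i = j \<or> \<sigma> j < \<sigma> i"
    using inj less.prems \<open>p \<le> n\<close> by (auto simp: inj_on_def)
  ultimately show ?case using E[OF less.prems(1,2)] by simp
qed

text \<open>Since \<open>H\<close> starts with identity rows, the first \<open>p\<close> columns of
  the congruence form \<open>H * E\<close>. Diagonality of its top block makes \<open>E\<close>
  diagonal; the lower block then vanishes because the diagonal of \<open>E\<close> is
  positive.\<close>

lemma diagonal_congruence_identity_top:
  fixes H E :: "real mat"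
  assumes H: "H \<in> carrier_mat n p" and E: "E \<in> carrier_mat p p" and "p \<le> n"
    and top: "\<And>i j. i < p \<Longrightarrow> j < p \<Longrightarrow> H $$ (i, j) = (if i = j then 1 else 0)"
    and E_pos: "\<And>i. i < p \<Longrightarrow> E $$ (i, i) > 0"
    and diag: "diagonal_mat (H * E * transpose_mat H)"
  shows "\<And>i j. i < p \<Longrightarrow> j < p \<Longrightarrow> i \<noteq> j \<Longrightarrow> E $$ (i, j) = 0"
    and "\<And>i j. i < n \<Longrightarrow> j < p \<Longrightarrow> H $$ (i, j) = (if i = j then 1 else 0)"
proof -
  have HE: "H * E \<in> carrier_mat n p" using H E by auto
  have HE0: "(H * E) $$ (i, j) = 0" if "i < n" "j < p" "i \<noteq> j" for i j
  proof -
    have jn: "j < n" using that \<open>p \<le> n\<close> by simp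
    have "0 = (H * E * transpose_mat H) $$ (i, j)"
      using diag that H E jn unfolding diagonal_mat_def by (metis carrier_matD(1) index_mult_mat(2,3) index_transpose_mat(3))
    also have "\<dots> = (\<Sum>k<p. (H * E) $$ (i, k) * H $$ (j, k))"
      using that jn H index_mult_mat_sum[OF HE, of "transpose_mat H" n i j]
      by (simp del: index_mult_mat(1))
    also have "\<dots> = (\<Sum>k<p. if k = j then (H * E) $$ (i, k) else 0)"
      using that by (intro sum.cong) (auto simp: top simp del: index_mult_mat(1))
    finally show ?thesis using that by simp
  qed
  show E0: "E $$ (i, j) = 0" if "i < p" "j < p" "i \<noteq> j" for i j
    using HE0[of i j] that \<open>p \<le> n\<close> identity_top_mult[OF H E \<open>p \<le> n\<close> top that(1,2)] by simp
  show "H $$ (i, j) = (if i = j then 1 else 0)" if ij: "i < n" "j < p" for i j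
  proof (cases "i < p")
    case True
    then show ?thesis using top ij by simp
  next
    case False
    with ij have "0 = (H * E) $$ (i, j)" using HE0 by simp
    also have "\<dots> = (\<Sum>k<p. H $$ (i, k) * E $$ (k, j))"
      by (rule index_mult_mat_sum[OF H E ij])
    also have "\<dots> = (\<Sum>k<p. if k = j then H $$ (i, k) * E $$ (j, j) else 0)"
      using ij E0 by (intro sum.cong) auto
    also have "\<dots> = H $$ (i, j) * E $$ (j, j)" using ij by simp
    finally show ?thesis using E_pos[OF ij(2)] False ij by simp
  qed
qed

text \<open>Back substitution makes \<open>W1\<close> unitriangular along \<sigma>. Multiplying by
  \<open>1\<^sub>m n - G0\<close> preserves this and exposes \<open>X\<close> as the top block, so
  \<open>X\<close> is unitriangular and carries one diagonal matrix to another.\<close>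

lemma triangular_loop_factor_trivial:
  fixes G0 G1 X :: "real mat"
  assumes G0: "G0 \<in> carrier_mat n n" and G1: "G1 \<in> carrier_mat n n"
    and W0: "W0 \<in> carrier_mat n p" and W1: "W1 \<in> carrier_mat n p" and X: "X \<in> carrier_mat p p"
    and pn: "p \<le> n" and inj: "inj_on \<sigma> {..<n}"
    and strict0: "\<And>i j. i < n \<Longrightarrow> j < n \<Longrightarrow> \<not> \<sigma> i < (\<sigma> j :: nat) \<Longrightarrow> G0 $$ (i, j) = 0"
    and strict1: "\<And>i j. i < n \<Longrightarrow> j < n \<Longrightarrow> \<not> \<sigma> i < \<sigma> j \<Longrightarrow> G1 $$ (i, j) = 0"
    and W0_eq: "\<And>i j. i < n \<Longrightarrow> j < p \<Longrightarrow> ((1\<^sub>m n - G0) * W0) $$ (i, j) = (if i = j then 1 else 0)"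
    and W1_eq: "\<And>i j. i < n \<Longrightarrow> j < p \<Longrightarrow> ((1\<^sub>m n - G1) * W1) $$ (i, j) = (if i = j then 1 else 0)"
    and W1X: "W1 = W0 * X" and E: "E \<in> carrier_mat p p"
    and E_diag: "\<And>i j. i < p \<Longrightarrow> j < p \<Longrightarrow> i \<noteq> j \<Longrightarrow> E $$ (i, j) = 0"
    and E_pos: "\<And>i. i < p \<Longrightarrow> E $$ (i, i) > 0"
    and diag: "\<And>i j. i < p \<Longrightarrow> j < p \<Longrightarrow> i \<noteq> j \<Longrightarrow> (X * E * transpose_mat X) $$ (i, j) = 0"
  shows "X = 1\<^sub>m p"
proof -
  have W1_tri: "W1 $$ (i, j) = (if i = j then 1 else 0)" if "i < n" "j < p" "\<not> \<sigma> i < \<sigma> j" for i j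
    by (rule unitriangular_solution[OF G1 W1 pn strict1 inj W1_eq]) (use that in auto)
  have X_tri: "X $$ (i, j) = (if i = j then 1 else 0)" if ij: "i < p" "j < p" "\<not> \<sigma> i < \<sigma> j" for i j
  proof -
    have i_n: "i < n" using ij pn by simp
    have A: "1\<^sub>m n - G0 \<in> carrier_mat n n" using G0 by auto
    have AW: "(1\<^sub>m n - G0) * W0 \<in> carrier_mat n p" using A W0 by auto
    have "X $$ (i, j) = ((1\<^sub>m n - G0) * W0 * X) $$ (i, j)"
      by (rule identity_top_mult[OF AW X pn _ ij(1,2), symmetric]) (use W0_eq pn in auto)
    also have "(1\<^sub>m n - G0) * W0 * X = (1\<^sub>m n - G0) * W1"
      unfolding W1X by (rule assoc_mult_mat[OF A W0 X])
    also have "\<dots> = W1 - G0 * W1"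
      using G0 W1 minus_mult_distrib_mat[of "1\<^sub>m n" n n G0 W1 p] by simp
    also have "\<dots> $$ (i, j) = W1 $$ (i, j) - (\<Sum>k<n. G0 $$ (i, k) * W1 $$ (k, j))"
      using i_n ij G0 W1 by (simp add: index_mult_mat_sum[OF G0 W1] del: index_mult_mat(1))
    also have "(\<Sum>k<n. G0 $$ (i, k) * W1 $$ (k, j)) = 0"
    proof (rule sum.neutral, rule ballI)
      fix k assume "k \<in> {..<n}"
      then have k: "k < n" by simp
      show "G0 $$ (i, k) * W1 $$ (k, j) = 0"
      proof (cases "\<sigma> i < \<sigma> k")
        case True
        then show ?thesis using W1_tri[OF k ij(2)] ij(3) by auto
      next
        case False
        then show ?thesis using strict0[OF i_n k] by simp
      qed
    qed
    finally show ?thesis using W1_tri[OF i_n ij(2,3)] by simp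
  qed
  show ?thesis
    by (rule unitriangular_congruence_diagonal[OF X E E_diag E_pos diag, where \<sigma> = \<sigma>])
      (auto simp: X_tri)
qed

text \<open>Conjugation by \<open>P\<close> renames indices by \<pi>, so \<sigma> is the inverse of
  \<pi>; the zero diagonal makes triangularity strict. One \<sigma> serves all \<open>G\<close>,
  hence all models of the set.\<close>

lemma permuted_upper_triangular_order:
  assumes "permutation_mat n P"
  obtains \<sigma> :: "nat \<Rightarrow> nat" where "inj_on \<sigma> {..<n}"
    and "\<And>G i j. G \<in> carrier_mat n n \<Longrightarrow> upper_triangular (transpose_mat P * G * P)
      \<Longrightarrow> (\<And>i. i < n \<Longrightarrow> G $$ (i, i) = 0) \<Longrightarrow> i < n \<Longrightarrow> j < n \<Longrightarrow> \<not> \<sigma> i < \<sigma> j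
      \<Longrightarrow> G $$ (i, j) = 0"
proof -
  obtain \<pi> where \<pi>: "\<pi> permutes {..<n}" and P_eq: "P = mat n n (\<lambda>(i, j). if i = \<pi> j then 1 else 0)"
    using assms unfolding permutation_mat_def by blast
  define \<rho> where "\<rho> = inv_into UNIV \<pi>"
  have \<rho>: "\<rho> permutes {..<n}" unfolding \<rho>_def by (rule permutes_inv[OF \<pi>])
  have \<pi>\<rho>: "\<pi> (\<rho> a) = a" for a
    unfolding \<rho>_def by (rule permutes_inverses(1)[OF \<pi>])
  have P: "P \<in> carrier_mat n n" by (simp add: P_eq)
  have less: "\<pi> a < n" "\<rho> a < n" if "a < n" for a
    using permutes_in_image[OF \<pi>, of a] permutes_in_image[OF \<rho>, of a] that by auto
  show ?thesis
  proof
    show inj: "inj_on (\<rho>) {..<n}"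
      using permutes_inj[OF \<rho>] by (rule inj_on_subset) simp
    fix G :: "real mat" and i j
    assume G: "G \<in> carrier_mat n n" and ut: "upper_triangular (transpose_mat P * G * P)"
      and diag: "\<And>i. i < n \<Longrightarrow> G $$ (i, i) = 0" and ij: "i < n" "j < n" and "\<not> \<rho> i < \<rho> j"
    have PG: "transpose_mat P * G \<in> carrier_mat n n" using P G by auto
    have "(transpose_mat P * G) $$ (a, k) = G $$ (\<pi> a, k)" if "a < n" "k < n" for a k
    proof -
      have "(transpose_mat P * G) $$ (a, k) = (\<Sum>l<n. transpose_mat P $$ (a, l) * G $$ (l, k))"
        using index_mult_mat_sum[OF _ G, of "transpose_mat P" n a k] P that by simp
      also have "\<dots> = (\<Sum>l<n. if l = \<pi> a then G $$ (\<pi> a, k) else 0)"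
        using that less by (intro sum.cong) (auto simp: P_eq)
      finally show ?thesis using less that by simp
    qed
    note row = this
    have ent: "(transpose_mat P * G * P) $$ (a, b) = G $$ (\<pi> a, \<pi> b)" if "a < n" "b < n" for a b
    proof -
      have "(transpose_mat P * G * P) $$ (a, b) = (\<Sum>k<n. (transpose_mat P * G) $$ (a, k) * P $$ (k, b))"
        by (rule index_mult_mat_sum[OF PG P that])
      also have "\<dots> = (\<Sum>k<n. if k = \<pi> b then G $$ (\<pi> a, \<pi> b) else 0)"
        using that row by (intro sum.cong) (auto simp: P_eq)
      finally show ?thesis using less that by simp
    qed
    show "G $$ (i, j) = 0"
    proof (cases "i = j")
      case True
      then show ?thesis using diag ij by simp
    next
      case False
      then have "\<rho> i \<noteq> \<rho> j"
        using inj ij by (auto simp: inj_on_def)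
      then have "\<rho> j < \<rho> i"
        using \<open>\<not> \<rho> i < \<rho> j\<close> by simp
      then have "(transpose_mat P * G * P) $$ (\<rho> i, \<rho> j) = 0"
        using ut P less ij by (intro upper_triangularD) auto
      then show ?thesis
        using ent less ij by (simp add: \<pi>\<rho>)
    qed
  qed
qed

subsection \<open>Identifiability\<close>

context
  fixes L K p :: nat and N :: network
  assumes model: "network_model L K p N"
begin

lemma model_carrier:
  "p \<le> L" "net_G N \<in> carrier_mat L L" "net_R N \<in> carrier_mat L K" "net_H N \<in> carrier_mat L p"
  "net_Lambda N \<in> carrier_mat p p" "1\<^sub>m L - net_G N \<in> carrier_mat L L"
  "minv (1\<^sub>m L - net_G N) \<in> carrier_mat L L"
  and model_inverse: "(1\<^sub>m L - net_G N) * minv (1\<^sub>m L - net_G N) = 1\<^sub>m L"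
    "minv (1\<^sub>m L - net_G N) * (1\<^sub>m L - net_G N) = 1\<^sub>m L"
  and model_stable: "stable_mat (net_G N)" "stable_mat (net_H N)"
    "stable_mat (minv (1\<^sub>m L - net_G N))" "stable_mat (1\<^sub>m L - net_G N)"
  and model_proper: "proper_mat (net_R N)"
  and model_pos_def: "pos_def_mat (net_Lambda N)"
  and model_G_diag: "\<And>i. i < L \<Longrightarrow> net_G N $$ (i, i) = 0"
proof -
  show G: "net_G N \<in> carrier_mat L L"
    using model unfolding network_model_def by blast
  show A: "1\<^sub>m L - net_G N \<in> carrier_mat L L"
    using minus_carrier_mat[OF G] .
  have inv: "invertible_mat (1\<^sub>m L - net_G N)"
    using model unfolding network_model_def by blast
  show "minv (1\<^sub>m L - net_G N) \<in> carrier_mat L L"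
    "(1\<^sub>m L - net_G N) * minv (1\<^sub>m L - net_G N) = 1\<^sub>m L"
    "minv (1\<^sub>m L - net_G N) * (1\<^sub>m L - net_G N) = 1\<^sub>m L"
    by (rule minv_inverse[OF A inv])+
  show st: "stable_mat (net_G N)"
    using model unfolding network_model_def by blast
  show "stable_mat (1\<^sub>m L - net_G N)"
    by (rule stable_mat_one_minus[OF G st])
qed (use model in \<open>unfold network_model_def, blast\<close>)+

lemma T_wr_eq: "T_wr N = minv (1\<^sub>m L - net_G N) * net_R N"
  and T_we_eq: "T_we N = minv (1\<^sub>m L - net_G N) * net_H N"
  and T_mat_eq: "T_mat N = minv (1\<^sub>m L - net_G N) * U_mat N"
  using model_carrier(2) by (auto simp: T_wr_def T_we_def T_mat_def)

lemma T_carrier: "T_wr N \<in> carrier_mat L K" "T_we N \<in> carrier_mat L p"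
  and U_carrier: "U_mat N \<in> carrier_mat L (K + p)"
  using model_carrier append_cols_carrier[OF model_carrier(3,4)]
  unfolding T_wr_eq T_we_eq U_mat_def by auto

lemma T_mat_append: "T_mat N = append_cols (T_wr N) (T_we N)"
  unfolding T_mat_eq T_wr_eq T_we_eq U_mat_def
  by (rule mult_append_cols[OF model_carrier(7,3,4)])

lemma loop_mult_T:
  "(1\<^sub>m L - net_G N) * T_wr N = net_R N" "(1\<^sub>m L - net_G N) * T_we N = net_H N"
  "(1\<^sub>m L - net_G N) * T_mat N = U_mat N"
  unfolding T_wr_eq T_we_eq T_mat_eq
  by (rule mat_mult_left_cancel[OF model_inverse(1) model_carrier(6,7)];
      rule model_carrier U_carrier)+

lemma T_we_stable: "stable_mat (T_we N)"
  unfolding T_we_eq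
  by (rule stable_mat_mult[OF model_carrier(7,4) model_stable(3,2)])

lemma T_wr_proper: "proper_mat (T_wr N)"
  unfolding T_wr_eq
  by (rule proper_mat_mult[OF model_carrier(7,3) stable_mat_imp_proper_mat[OF model_stable(3)]
        model_proper])

text \<open>As \<open>(1\<^sub>m L - net_G N) * T_we N\<close> is \<open>net_H N\<close>, the stable
  left inverse of \<open>net_H N\<close> only has to be multiplied by the stable loop
  matrix.\<close>

lemma T_we_stable_left_inverse:
  obtains V where "V \<in> carrier_mat p L" "stable_mat V" "V * T_we N = 1\<^sub>m p"
proof -
  obtain Hd where Hd: "Hd \<in> carrier_mat p L" "stable_mat Hd" "Hd * net_H N = 1\<^sub>m p"
    using model unfolding network_model_def by blast
  show ?thesis
  proof
    show "Hd * (1\<^sub>m L - net_G N) \<in> carrier_mat p L"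
      using Hd model_carrier by auto
    show "stable_mat (Hd * (1\<^sub>m L - net_G N))"
      by (rule stable_mat_mult[OF Hd(1) model_carrier(6) Hd(2) model_stable(4)])
    show "Hd * (1\<^sub>m L - net_G N) * T_we N = 1\<^sub>m p"
      using assoc_mult_mat[OF Hd(1) model_carrier(6) T_carrier(2)] by (simp add: loop_mult_T Hd(3))
  qed
qed

lemma loop_inf: "mat_inf (1\<^sub>m L - net_G N) = 1\<^sub>m L - mat_inf (net_G N)"
  by (rule mat_inf_one_minus[OF model_carrier(2) stable_mat_imp_proper_mat[OF model_stable(1)]])

lemma loop_mult_T_inf:
  "(1\<^sub>m L - mat_inf (net_G N)) * mat_inf (T_wr N) = mat_inf (net_R N)"
  "(1\<^sub>m L - mat_inf (net_G N)) * mat_inf (T_we N) = mat_inf (net_H N)"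
  unfolding loop_inf[symmetric] loop_mult_T[symmetric]
  using mat_inf_mult[OF model_carrier(6) T_carrier(1)] mat_inf_mult[OF model_carrier(6) T_carrier(2)]
  by (simp_all add: T_wr_proper T_we_stable model_stable(4) stable_mat_imp_proper_mat)

lemma H_inf_top:
  assumes "i < p" "j < p"
  shows "mat_inf (net_H N) $$ (i, j) = (if i = j then 1 else 0)"
proof -
  obtain Ha Hb where Ha: "Ha \<in> carrier_mat p p" and Hb: "Hb \<in> carrier_mat (L - p) p"
    and H: "net_H N = Ha @\<^sub>r Hb" and monic: "monic_mat Ha"
    using model unfolding network_model_def by blast
  have "net_H N $$ (i, j) = Ha $$ (i, j)"
    using Ha Hb assms unfolding H append_rows_def by auto
  moreover have "mat_inf (net_H N) $$ (i, j) = rf_inf (net_H N $$ (i, j))"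
    using assms model_carrier by (simp add: mat_inf_def)
  moreover have "mat_inf Ha $$ (i, j) = rf_inf (Ha $$ (i, j))"
    using assms Ha by (simp add: mat_inf_def)
  moreover have "mat_inf Ha = 1\<^sub>m p"
    using monic Ha by (simp add: monic_mat_def)
  ultimately show ?thesis using assms by simp
qed

end

section \<open>From equal spectra to equal noise transfer and covariance\<close>

text \<open>Multiplying \<open>W\<close> by the common loop matrix at infinity relates the
  feedthroughs of \<open>H\<close> by \<open>X\<close>; both have an identity top block.\<close>

lemma spectral_factor_trivial_if_G_inf_eq:
  assumes N0: "network_model L K p N0" and N1: "network_model L K p N1"
    and G: "mat_inf (net_G N1) = mat_inf (net_G N0)"
    and X: "X \<in> carrier_mat p p" and W: "mat_inf (T_we N1) = mat_inf (T_we N0) * X"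
  shows "X = 1\<^sub>m p"
proof (rule mat_eq_entries[OF X])
  note c0 = model_carrier[OF N0]
  have A: "1\<^sub>m L - mat_inf (net_G N0) \<in> carrier_mat L L"
    using c0(2) by (intro minus_carrier_mat) (simp add: mat_inf_def)
  have H: "mat_inf (net_H N1) = mat_inf (net_H N0) * X"
    using assoc_mult_mat[OF A mat_inf_carrier[OF T_carrier(2)[OF N0]] X]
    by (simp add: loop_mult_T_inf(2)[OF N1, symmetric] loop_mult_T_inf(2)[OF N0, symmetric] G W)
  fix i j assume ij: "i < p" "j < p"
  have "X $$ (i, j) = (mat_inf (net_H N0) * X) $$ (i, j)"
    by (rule identity_top_mult[OF mat_inf_carrier[OF c0(4)] X c0(1) H_inf_top[OF N0] ij, symmetric])
  then show "X $$ (i, j) = 1\<^sub>m p $$ (i, j)"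
    using H_inf_top[OF N1 ij] ij by (simp flip: H)
qed simp

lemma not_parametrizedD:
  "\<not> parametrized \<Theta> A i j \<Longrightarrow> \<theta>1 \<in> \<Theta> \<Longrightarrow> \<theta>2 \<in> \<Theta> \<Longrightarrow> A \<theta>1 $$ (i, j) = A \<theta>2 $$ (i, j)"
  unfolding parametrized_def by blast

text \<open>Both models satisfy \<open>R_inf = (1\<^sub>m L - G_inf) * T\<close> at infinity with
  the same \<open>T\<close>. In row \<open>i\<close>, the difference of the two \<open>G_inf\<close>
  is supported on the parametrized positions, and the columns where \<open>R_inf\<close> is fixed
  put it into the left kernel of \<open>T_check_inf\<close>.\<close>

lemma G_inf_eq_if_C3:
  assumes set: "network_model_set L K p \<Theta> M" and C3: "cond_C3 L K \<Theta> M"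
    and \<theta>: "\<theta>0 \<in> \<Theta>" "\<theta>1 \<in> \<Theta>" and T: "T_wr (M \<theta>1) = T_wr (M \<theta>0)"
  shows "mat_inf (net_G (M \<theta>1)) = mat_inf (net_G (M \<theta>0))"
proof -
  have N: "network_model L K p (M \<theta>0)" "network_model L K p (M \<theta>1)"
    using set \<theta> by (simp_all add: network_model_set_def)
  let ?T = "mat_inf (T_wr (M \<theta>1))"
  have Tc: "?T \<in> carrier_mat L K" by (rule mat_inf_carrier[OF T_carrier(1)[OF N(2)]])
  have Gc: "G_inf M \<theta>0 \<in> carrier_mat L L" "G_inf M \<theta>1 \<in> carrier_mat L L"
    using model_carrier(2)[OF N(1)] model_carrier(2)[OF N(2)] by (simp_all add: G_inf_def mat_inf_def)
  have R: "R_inf M \<theta> $$ (i, k) = ?T $$ (i, k) - (\<Sum>j<L. G_inf M \<theta> $$ (i, j) * ?T $$ (j, k))"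
    if "i < L" "k < K" and \<theta>': "\<theta> = \<theta>0 \<or> \<theta> = \<theta>1" for i k \<theta>
  proof -
    have NN: "network_model L K p (M \<theta>)" and TT: "T_wr (M \<theta>) = T_wr (M \<theta>1)"
      using \<theta>' N T by auto
    have G: "G_inf M \<theta> \<in> carrier_mat L L" using \<theta>' Gc by auto
    have "R_inf M \<theta> = (1\<^sub>m L - G_inf M \<theta>) * ?T"
      using loop_mult_T_inf(1)[OF NN] by (simp add: R_inf_def G_inf_def TT)
    also have "\<dots> = ?T - G_inf M \<theta> * ?T"
      using G Tc minus_mult_distrib_mat[of "1\<^sub>m L" L L "G_inf M \<theta>" ?T K] by simp
    finally show ?thesis
      using G Tc that by (simp add: index_mult_mat_sum[OF G Tc] del: index_mult_mat(1))
  qed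
  have "G_inf M \<theta>1 = G_inf M \<theta>0"
  proof (rule mat_eq_entries[OF Gc(2,1)])
    fix i j assume ij: "i < L" "j < L"
    let ?I = "{j. j < L \<and> parametrized \<Theta> (G_inf M) i j}"
    let ?J = "{k. k < K \<and> \<not> parametrized \<Theta> (R_inf M) i k}"
    let ?u = "\<lambda>j. G_inf M \<theta>1 $$ (i, j) - G_inf M \<theta>0 $$ (i, j)"
    have u0: "?u j = 0" if "j \<notin> ?I" "j < L" for j
      using that not_parametrizedD[OF _ \<theta>, of "G_inf M" i j] by simp
    have "full_row_rank (submatrix ?T ?I ?J)"
      using C3 \<theta>(2) ij(1) unfolding cond_C3_def T_check_inf_def by blast
    moreover have "(\<Sum>j\<in>?I. ?u j * ?T $$ (j, k)) = 0" if k: "k \<in> ?J" for k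
    proof -
      have "(\<Sum>j\<in>?I. ?u j * ?T $$ (j, k)) = (\<Sum>j<L. ?u j * ?T $$ (j, k))"
        using u0 by (intro sum.mono_neutral_left) auto
      \<comment> \<open>The common term \<open>?T $$ (i, k)\<close> cancels, which leaves the
        difference of the products with \<open>G_inf\<close>.\<close>
      also have "\<dots> = R_inf M \<theta>0 $$ (i, k) - R_inf M \<theta>1 $$ (i, k)"
        using k ij by (simp add: R left_diff_distrib sum_subtractf)
      also have "\<dots> = 0"
        using k not_parametrizedD[OF _ \<theta>, of "R_inf M" i k] by simp
      finally show ?thesis .
    qed
    ultimately have "?u j = 0" if "j \<in> ?I"
      using full_row_rank_submatrix_left_kernel[OF Tc _ _ _ _ that, of ?J ?u] by auto
    then show "G_inf M \<theta>1 $$ (i, j) = G_inf M \<theta>0 $$ (i, j)"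
      using u0[of j] ij by auto
  qed
  then show ?thesis by (simp add: G_inf_def)
qed

text \<open>The diagonal feedthrough covariance makes each \<open>net_Lambda\<close> diagonal and
  reduces \<open>H\<close> at infinity to an identity above zeros; the absence of algebraic loops
  provides a common order. \<open>triangular_loop_factor_trivial\<close> then applies.\<close>

lemma spectral_factor_trivial_if_C2:
  assumes set: "network_model_set L K p \<Theta> M" and C2: "cond_C2 L \<Theta> M"
    and \<theta>: "\<theta>0 \<in> \<Theta>" "\<theta>1 \<in> \<Theta>"
    and X: "X \<in> carrier_mat p p" and W: "mat_inf (T_we (M \<theta>1)) = mat_inf (T_we (M \<theta>0)) * X"
    and XX: "X * net_Lambda (M \<theta>1) * transpose_mat X = net_Lambda (M \<theta>0)"
  shows "X = 1\<^sub>m p"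
proof -
  have N: "network_model L K p (M \<theta>)" if "\<theta> \<in> \<Theta>" for \<theta>
    using set that by (simp add: network_model_set_def)
  obtain P where P: "permutation_mat L P"
    and ut: "\<And>\<theta>. \<theta> \<in> \<Theta> \<Longrightarrow> upper_triangular (transpose_mat P * G_inf M \<theta> * P)"
    and dg: "\<And>\<theta>. \<theta> \<in> \<Theta> \<Longrightarrow> diagonal_mat (H_inf M \<theta> * net_Lambda (M \<theta>) * transpose_mat (H_inf M \<theta>))"
    using C2 unfolding cond_C2_def by blast
  obtain \<sigma> :: "nat \<Rightarrow> nat" where inj: "inj_on \<sigma> {..<L}"
    and \<sigma>: "\<And>G i j. G \<in> carrier_mat L L \<Longrightarrow> upper_triangular (transpose_mat P * G * P)
      \<Longrightarrow> (\<And>i. i < L \<Longrightarrow> G $$ (i, i) = 0) \<Longrightarrow> i < L \<Longrightarrow> j < L \<Longrightarrow> \<not> \<sigma> i < \<sigma> j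
      \<Longrightarrow> G $$ (i, j) = 0"
    using permuted_upper_triangular_order[OF P] by blast
  have Gc: "mat_inf (net_G (M \<theta>)) \<in> carrier_mat L L" if "\<theta> \<in> \<Theta>" for \<theta>
    by (rule mat_inf_carrier[OF model_carrier(2)[OF N[OF that]]])
  have strict: "mat_inf (net_G (M \<theta>)) $$ (i, j) = 0"
    if "\<theta> \<in> \<Theta>" "i < L" "j < L" "\<not> \<sigma> i < \<sigma> j" for \<theta> i j
  proof (rule \<sigma>[OF Gc[OF that(1)] _ _ that(2-4)])
    show "upper_triangular (transpose_mat P * mat_inf (net_G (M \<theta>)) * P)"
      using ut[OF that(1)] by (simp add: G_inf_def)
    show "mat_inf (net_G (M \<theta>)) $$ (i, i) = 0" if "i < L" for i
      using model_G_diag[OF N[OF \<open>\<theta> \<in> \<Theta>\<close>] that] model_carrier(2)[OF N[OF \<open>\<theta> \<in> \<Theta>\<close>]] that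
      by (simp add: mat_inf_def rf_inf_0)
  qed
  have pos: "net_Lambda (M \<theta>) $$ (i, i) > 0" if "\<theta> \<in> \<Theta>" "i < p" for \<theta> i
    by (rule pos_def_mat_diag_pos[OF model_carrier(5) model_pos_def that(2)]) (rule N[OF that(1)])+
  have E_diag: "net_Lambda (M \<theta>) $$ (i, j) = 0"
    if "\<theta> \<in> \<Theta>" "i < p" "j < p" "i \<noteq> j" for \<theta> i j
    by (rule diagonal_congruence_identity_top(1)[OF mat_inf_carrier[OF model_carrier(4)[OF N]]
          model_carrier(5)[OF N] model_carrier(1)[OF N] H_inf_top[OF N] pos dg[unfolded H_inf_def]])
      (use that in auto)
  have Hinf: "((1\<^sub>m L - mat_inf (net_G (M \<theta>))) * mat_inf (T_we (M \<theta>))) $$ (i, j) = (if i = j then 1 else 0)"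
    if "\<theta> \<in> \<Theta>" "i < L" "j < p" for \<theta> i j
    unfolding loop_mult_T_inf(2)[OF N[OF that(1)]] 
    by (rule diagonal_congruence_identity_top(2)[OF mat_inf_carrier[OF model_carrier(4)[OF N]]
          model_carrier(5)[OF N] model_carrier(1)[OF N] H_inf_top[OF N] pos dg[unfolded H_inf_def]])
      (use that in auto)
  show ?thesis
  proof (rule triangular_loop_factor_trivial[OF Gc[OF \<theta>(1)] Gc[OF \<theta>(2)]
        mat_inf_carrier[OF T_carrier(2)[OF N[OF \<theta>(1)]]] mat_inf_carrier[OF T_carrier(2)[OF N[OF \<theta>(2)]]]
        X model_carrier(1)[OF N[OF \<theta>(1)]] inj strict[OF \<theta>(1)] strict[OF \<theta>(2)]
        Hinf[OF \<theta>(1)] Hinf[OF \<theta>(2)] W model_carrier(5)[OF N[OF \<theta>(2)]] _ pos[OF \<theta>(2)]])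
    show "net_Lambda (M \<theta>1) $$ (i, j) = 0" if "i < p" "j < p" "i \<noteq> j" for i j
      by (rule E_diag[OF \<theta>(2) that])
    show "(X * net_Lambda (M \<theta>1) * transpose_mat X) $$ (i, j) = 0" if "i < p" "j < p" "i \<noteq> j" for i j
      \<comment> \<open>The congruence yields the covariance of the other model, which is diagonal
        too.\<close>
      unfolding XX by (rule E_diag[OF \<theta>(1) that])
  qed auto
qed

text \<open>The noise factors differ by a constant matrix \<open>X\<close>, and each of the three
  conditions forces it to be the identity; under (C3) equality of \<open>T_wr\<close> supplies the
  equal feedthroughs of \<open>G\<close>.\<close>

lemma T_we_Lambda_eq:
  assumes set: "network_model_set L K p \<Theta> M"
    and C: "cond_C1 L \<Theta> M \<or> cond_C2 L \<Theta> M \<or> cond_C3 L K \<Theta> M"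
    and \<theta>: "\<theta>0 \<in> \<Theta>" "\<theta>1 \<in> \<Theta>" and T: "T_wr (M \<theta>1) = T_wr (M \<theta>0)"
    and spec: "\<And>\<omega>. noise_spectrum (M \<theta>1) \<omega> = noise_spectrum (M \<theta>0) \<omega>"
  shows "T_we (M \<theta>1) = T_we (M \<theta>0)" "net_Lambda (M \<theta>1) = net_Lambda (M \<theta>0)"
proof -
  have N0: "network_model L K p (M \<theta>0)" and N1: "network_model L K p (M \<theta>1)"
    using set \<theta> by (simp_all add: network_model_set_def)
  obtain V0 where V0: "V0 \<in> carrier_mat p L" "stable_mat V0" "V0 * T_we (M \<theta>0) = 1\<^sub>m p"
    using T_we_stable_left_inverse[OF N0] by blast
  obtain V1 where V1: "V1 \<in> carrier_mat p L" "stable_mat V1" "V1 * T_we (M \<theta>1) = 1\<^sub>m p"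
    using T_we_stable_left_inverse[OF N1] by blast
  obtain X where X: "X \<in> carrier_mat p p" and W: "T_we (M \<theta>1) = T_we (M \<theta>0) * map_mat rf_const X"
    and XX: "X * net_Lambda (M \<theta>1) * transpose_mat X = net_Lambda (M \<theta>0)"
    using spectral_factor_unique[OF T_carrier(2)[OF N0] T_we_stable[OF N0] T_carrier(2)[OF N1]
        T_we_stable[OF N1] V0 V1 model_carrier(5)[OF N0] model_carrier(5)[OF N1]
        model_pos_def[OF N1] spec[unfolded noise_spectrum_def]] by blast
  have Winf: "mat_inf (T_we (M \<theta>1)) = mat_inf (T_we (M \<theta>0)) * X"
    using mat_inf_mult[OF T_carrier(2)[OF N0], of "map_mat rf_const X" p] X
      stable_mat_imp_proper_mat[OF T_we_stable[OF N0]]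
      stable_mat_imp_proper_mat[OF stable_mat_const[of X]]
    by (simp add: W mat_inf_const)
  have "X = 1\<^sub>m p"
    using C
  proof (elim disjE)
    assume "cond_C1 L \<Theta> M"
    then have "mat_inf (net_G (M \<theta>1)) = mat_inf (net_G (M \<theta>0))"
      using \<theta> by (simp add: cond_C1_def G_inf_def)
    then show ?thesis by (rule spectral_factor_trivial_if_G_inf_eq[OF N0 N1 _ X Winf])
  next
    assume "cond_C2 L \<Theta> M"
    then show ?thesis by (rule spectral_factor_trivial_if_C2[OF set _ \<theta> X Winf XX])
  next
    assume "cond_C3 L K \<Theta> M"
    from G_inf_eq_if_C3[OF set this \<theta> T] show ?thesis
      by (rule spectral_factor_trivial_if_G_inf_eq[OF N0 N1 _ X Winf])
  qed
  then show "T_we (M \<theta>1) = T_we (M \<theta>0)" "net_Lambda (M \<theta>1) = net_Lambda (M \<theta>0)"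
    using W XX T_carrier(2)[OF N0] model_carrier(5)[OF N1] by (simp_all add: map_mat_rf_const_one)
qed

section \<open>From equal transfer matrices to equal models\<close>

lemma model_eq_if_T_mat_eq:
  assumes N0: "network_model L K p N0" and N1: "network_model L K p N1"
    and T: "T_mat N1 = T_mat N0" and Lam: "net_Lambda N1 = net_Lambda N0"
    and Q: "Q \<in> carrier_mat (K + p) (K + p)"
    and d0: "diagonal_factorization L K p Q N0" and d1: "diagonal_factorization L K p Q N1"
  shows "N1 = N0"
proof -
  obtain D0 F0 where D0: "D0 \<in> carrier_mat L L" "diagonal_mat D0" "vec_space.rank L D0 = L"
    and F0: "F0 \<in> carrier_mat L (p + K - L)" and DF0: "U_mat N0 * Q = append_cols D0 F0"
    using d0 unfolding diagonal_factorization_def by blast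
  obtain D1 F1 where D1: "D1 \<in> carrier_mat L L" "diagonal_mat D1"
    and F1: "F1 \<in> carrier_mat L (p + K - L)" and DF1: "U_mat N1 * Q = append_cols D1 F1"
    using d1 unfolding diagonal_factorization_def by blast
  note c0 = model_carrier[OF N0] and c1 = model_carrier[OF N1]
  let ?A0 = "1\<^sub>m L - net_G N0" and ?A1 = "1\<^sub>m L - net_G N1"
  have "minv ?A1 * append_cols D1 F1 = minv ?A0 * append_cols D0 F0"
    using T unfolding T_mat_eq[OF N0] T_mat_eq[OF N1] DF0[symmetric] DF1[symmetric]
    using assoc_mult_mat[OF c0(7) U_carrier[OF N0] Q] assoc_mult_mat[OF c1(7) U_carrier[OF N1] Q]
    by simp
  then have "append_cols (minv ?A1 * D1) (minv ?A1 * F1) = append_cols (minv ?A0 * D0) (minv ?A0 * F0)"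
    by (simp add: mult_append_cols[OF c0(7) D0(1) F0] mult_append_cols[OF c1(7) D1(1) F1])
  \<comment> \<open>The first \<open>L\<close> columns of \<open>T_mat * Q\<close> agree for the two
    models.\<close>
  then have BD: "minv ?A1 * D1 = minv ?A0 * D0"
    by (rule append_cols_inject(1)[rotated 4])
      (use mult_carrier_mat[OF c0(7) D0(1)] mult_carrier_mat[OF c1(7) D1(1)]
        mult_carrier_mat[OF c0(7) F0] mult_carrier_mat[OF c1(7) F1] in auto)
  \<comment> \<open>\<open>C\<close> turns one loop matrix into the other. By \<open>BD\<close> it
    also maps \<open>D0\<close> to \<open>D1\<close>, which will make it diagonal.\<close>
  define C where "C = ?A1 * minv ?A0"
  have C: "C \<in> carrier_mat L L" using mult_carrier_mat[OF c1(6) c0(7)] by (simp add: C_def)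
  have CA: "C * ?A0 = ?A1"
    using assoc_mult_mat[OF c1(6) c0(7) c0(6)] right_mult_one_mat[OF c1(6)]
    by (simp add: C_def model_inverse[OF N0])
  have "D1 = ?A1 * (minv ?A1 * D1)"
    by (rule mat_mult_left_cancel[OF model_inverse(1)[OF N1] c1(6,7) D1(1), symmetric])
  also have "\<dots> = C * D0"
    unfolding BD C_def by (rule assoc_mult_mat[OF c1(6) c0(7) D0(1), symmetric])
  finally have D1_eq: "D1 = C * D0" .
  have C0: "C $$ (i, j) = 0" if ij: "i < L" "j < L" "i \<noteq> j" for i j
  proof -
    have "D1 $$ (i, j) = (\<Sum>k<L. C $$ (i, k) * D0 $$ (k, j))"
      unfolding D1_eq by (rule index_mult_mat_sum[OF C D0(1) ij(1,2)])
    also have "\<dots> = (\<Sum>k<L. if k = j then C $$ (i, j) * D0 $$ (j, j) else 0)"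
      using D0(1,2) ij by (intro sum.cong) (auto simp: diagonal_mat_def)
    finally have "C $$ (i, j) * D0 $$ (j, j) = 0"
      using D1 ij by (simp add: diagonal_mat_def)
    then show ?thesis
      using diagonal_mat_full_rank_nonzero[OF D0 ij(2)] by simp
  qed
  have A1_ent: "?A1 $$ (i, j) = C $$ (i, i) * ?A0 $$ (i, j)" if "i < L" "j < L" for i j
  proof -
    have "?A1 $$ (i, j) = (\<Sum>k<L. C $$ (i, k) * ?A0 $$ (k, j))"
      unfolding CA[symmetric] by (rule index_mult_mat_sum[OF C c0(6) that])
    also have "\<dots> = (\<Sum>k<L. if k = i then C $$ (i, i) * ?A0 $$ (i, j) else 0)"
      using C0 that by (intro sum.cong) auto
    finally show ?thesis using that by simp
  qed
  \<comment> \<open>Both loop matrices have ones on the diagonal because \<open>net_G\<close> has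
    zeros there.\<close>
  have "C $$ (i, i) = 1" if "i < L" for i
    using A1_ent[OF that that] that model_G_diag[OF N0 that] model_G_diag[OF N1 that] c0(2) c1(2)
    by simp
  then have A: "?A1 = ?A0"
    using A1_ent by (intro mat_eq_entries[OF c1(6) c0(6)]) auto
  have "net_G N1 = net_G N0"
  proof (rule mat_eq_entries[OF c1(2) c0(2)])
    fix i j assume "i < L" "j < L"
    then show "net_G N1 $$ (i, j) = net_G N0 $$ (i, j)"
      using arg_cong[OF A, of "\<lambda>A. A $$ (i, j)"] c0(2) c1(2) by simp
  qed
  moreover have "U_mat N1 = U_mat N0"
    using loop_mult_T(3)[OF N1] loop_mult_T(3)[OF N0] A T by simp
  then have "net_R N1 = net_R N0" "net_H N1 = net_H N0"
    unfolding U_mat_def by (rule append_cols_inject[OF c1(3) c0(3) c1(4) c0(4)])+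
  ultimately show ?thesis using Lam by simp
qed

theorem theorem1:
  fixes L K p :: nat
    and \<Theta> :: "'t set"
    and M :: "'t \<Rightarrow> network"
  assumes "network_model_set L K p \<Theta> M"
    and "cond_C1 L \<Theta> M \<or> cond_C2 L \<Theta> M \<or> cond_C3 L K \<Theta> M"
  shows "(\<forall>\<theta>0\<in>\<Theta>.
            (\<exists>Q \<in> carrier_mat (K + p) (K + p). invertible_mat Q \<and>
               (\<forall>\<theta> \<in> {\<theta> \<in> \<Theta>. T_mat (M \<theta>) = T_mat (M \<theta>0)}.
                  diagonal_factorization L K p Q (M \<theta>)))
            \<longrightarrow> globally_identifiable_at \<Theta> M \<theta>0) \<and>
         ((\<exists>Q \<in> carrier_mat (K + p) (K + p). invertible_mat Q \<and>
             (\<forall>\<theta>\<in>\<Theta>. diagonal_factorization L K p Q (M \<theta>)))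
            \<longrightarrow> (\<forall>\<theta>0\<in>\<Theta>. \<forall>\<theta>1\<in>\<Theta>.
                  T_mat (M \<theta>1) = T_mat (M \<theta>0) \<and> net_Lambda (M \<theta>1) = net_Lambda (M \<theta>0)
                  \<longrightarrow> M \<theta>1 = M \<theta>0))"
proof (intro conjI ballI impI)
  have N: "network_model L K p (M \<theta>)" if "\<theta> \<in> \<Theta>" for \<theta>
    using assms(1) that by (simp add: network_model_set_def)
  {
    fix \<theta>0
    assume \<theta>0: "\<theta>0 \<in> \<Theta>" and "\<exists>Q \<in> carrier_mat (K + p) (K + p). invertible_mat Q \<and>
      (\<forall>\<theta> \<in> {\<theta> \<in> \<Theta>. T_mat (M \<theta>) = T_mat (M \<theta>0)}. diagonal_factorization L K p Q (M \<theta>))"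
    then obtain Q where Q: "Q \<in> carrier_mat (K + p) (K + p)"
      and df: "\<And>\<theta>. \<theta> \<in> \<Theta> \<Longrightarrow> T_mat (M \<theta>) = T_mat (M \<theta>0) \<Longrightarrow> diagonal_factorization L K p Q (M \<theta>)"
      by blast
    show "globally_identifiable_at \<Theta> M \<theta>0"
      unfolding globally_identifiable_at_def
    proof (intro ballI impI, elim conjE)
      fix \<theta>1
      assume \<theta>1: "\<theta>1 \<in> \<Theta>" and Twr: "T_wr (M \<theta>1) = T_wr (M \<theta>0)"
        and spec: "\<forall>\<omega>. noise_spectrum (M \<theta>1) \<omega> = noise_spectrum (M \<theta>0) \<omega>"
      note eq = T_we_Lambda_eq[OF assms \<theta>0 \<theta>1 Twr spec[rule_format]]
      \<comment> \<open>This places \<theta>1 in the set on which \<open>Q\<close> is assumed to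
        diagonalize, so \<open>df\<close> becomes available for it.\<close>
      have T: "T_mat (M \<theta>1) = T_mat (M \<theta>0)"
        by (simp add: T_mat_append[OF N[OF \<theta>0]] T_mat_append[OF N[OF \<theta>1]] Twr eq(1))
      show "M \<theta>1 = M \<theta>0"
        by (rule model_eq_if_T_mat_eq[OF N[OF \<theta>0] N[OF \<theta>1] T eq(2) Q df[OF \<theta>0 refl] df[OF \<theta>1 T]])
    qed
  }
  fix \<theta>0 \<theta>1
  assume "\<exists>Q \<in> carrier_mat (K + p) (K + p). invertible_mat Q \<and>
      (\<forall>\<theta>\<in>\<Theta>. diagonal_factorization L K p Q (M \<theta>))"
    and \<theta>: "\<theta>0 \<in> \<Theta>" "\<theta>1 \<in> \<Theta>"
    and "T_mat (M \<theta>1) = T_mat (M \<theta>0) \<and> net_Lambda (M \<theta>1) = net_Lambda (M \<theta>0)"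
  then show "M \<theta>1 = M \<theta>0"
    using model_eq_if_T_mat_eq[OF N[OF \<theta>(1)] N[OF \<theta>(2)]] by blast
qed

end
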